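(* Let $G$ be a finite group satisfying $\mathrm{sub}(G)<59\cdot2^{\pi(G)-3}$. Then $$G\cong A\times S\times C,$$ where $A$ is cyclic of squarefree order, $C$ is cyclic, $\gcd(|A|,|S||C|)=1$, $\gcd(|S|,|C|)=1$, either $S=1$ or $S$ is a fundamental block for the subgroup-count threshold, and $$\lambda(S)\,\delta(C)<\frac{59}{8}.$$ Moreover, writing $C\cong C_{\ell_1^{a_1}}\times\cdots\times C_{\ell_r^{a_r}}$ with distinct primes $\ell_i$ and nontrivial factors, every exponent satisfies $a_i\ge2$. Conversely, every product $A\times S\times C$ with all these properties satisfies $\mathrm{sub}(G)<59\cdot2^{\pi(G)-3}$. When $S=1$, the possible exponent patterns for $C$, ordered as $a_1\ge\cdots\ge a_r\ge2$, are exactly: - $r=0$: empty; - $r=1$: $2\le a_1\le13$; - $r=2$: $(a_1+1)(a_2+1)\le29$; - $r=3$: $(a,2,2)$ with $2\le a\le5$, or $(3,3,2)$; - $r=4$: $(3,2,2,2)$ or $(2,2,2,2)$.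
   Context: For a finite group $G$, $\mathrm{sub}(G)$ is the number of subgroups of $G$, $\pi(G)$ is the number of distinct prime divisors of $|G|$ ($\pi(1)=0$), and $\lambda(G)=\mathrm{sub}(G)/2^{\pi(G)}$, so $\lambda(1)=1$. For a cyclic group $C$, $\delta(C)=d(|C|)/2^{\pi(C)}$, where $d(k)$ is the number of positive divisors of $k$. $C_k$ is the cyclic group of order $k$. A finite group is squarefree-reduced if it has no central Sylow subgroup of prime order. A fundamental block for the subgroup-count threshold is a nontrivial squarefree-reduced finite group $S$ that has no central cyclic Sylow subgroup (for any prime dividing $|S|$) and satisfies $\lambda(S)<59/8$. *)

theory Defs
  imports
    Complex_Main
    "HOL-Algebra.Elementary_Groups"
    "HOL-Algebra.Product_Groups"
    "HOL-Computational_Algebra.Primes"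
    "HOL-Computational_Algebra.Squarefree"
begin

definition finite_group :: "('a, 'm) monoid_scheme \<Rightarrow> bool" where
  "finite_group G \<longleftrightarrow> group G \<and> finite (carrier G)"

definition sub_count :: "('a, 'm) monoid_scheme \<Rightarrow> nat" where
  "sub_count G = card {H. subgroup H G}"

definition prime_count :: "('a, 'm) monoid_scheme \<Rightarrow> nat" where
  "prime_count G = card (prime_factors (order G))"

definition group_lambda :: "('a, 'm) monoid_scheme \<Rightarrow> real" where
  "group_lambda G = real (sub_count G) / 2 ^ prime_count G"

definition group_delta :: "('a, 'm) monoid_scheme \<Rightarrow> real" where
  "group_delta C = real (card {k. k dvd order C}) / 2 ^ prime_count C"

definition group_center :: "('a, 'm) monoid_scheme \<Rightarrow> 'a set" where
  "group_center G = {z \<in> carrier G. \<forall>g \<in> carrier G. z \<otimes>\<^bsub>G\<^esub> g = g \<otimes>\<^bsub>G\<^esub> z}"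

text \<open>If \<open>p\<close> does not divide the order of \<open>G\<close>, the Sylow \<open>p\<close>-subgroup is trivial.\<close>

definition sylow_subgroup :: "('a, 'm) monoid_scheme \<Rightarrow> nat \<Rightarrow> 'a set \<Rightarrow> bool" where
  "sylow_subgroup G p P \<longleftrightarrow>
     prime p \<and> subgroup P G \<and> card P = p ^ multiplicity p (order G)"

definition squarefree_reduced :: "('a, 'm) monoid_scheme \<Rightarrow> bool" where
  "squarefree_reduced G \<longleftrightarrow>
     \<not> (\<exists>p P. sylow_subgroup G p P \<and> P \<subseteq> group_center G \<and> prime (card P))"

definition fundamental_block :: "('a, 'm) monoid_scheme \<Rightarrow> bool" where
  "fundamental_block S \<longleftrightarrow>
     finite_group S \<and> \<not> trivial_group S \<and> squarefree_reduced S \<and>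
     \<not> (\<exists>p P. p dvd order S \<and> sylow_subgroup S p P \<and> P \<subseteq> group_center S \<and>
             cyclic_group (subgroup_generated S P)) \<and>
     group_lambda S < 59 / 8"

text \<open>\<open>C\<close> is isomorphic to the product of cyclic groups of orders \<open>ls ! i ^ as ! i\<close>, for distinct
  primes \<open>ls ! i\<close> and exponents \<open>as ! i \<ge> 1\<close>; empty lists give the trivial group.\<close>

definition primary_decomposition ::
    "('a, 'm) monoid_scheme \<Rightarrow> nat list \<Rightarrow> nat list \<Rightarrow> bool" where
  "primary_decomposition C ls as \<longleftrightarrow>
     length ls = length as \<and> distinct ls \<and> (\<forall>l \<in> set ls. prime l) \<and> (\<forall>a \<in> set as. 1 \<le> a) \<and>
     C \<cong> product_group {..<length as} (\<lambda>i. integer_mod_group (ls ! i ^ as ! i))"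

definition exponent_pattern :: "('a, 'm) monoid_scheme \<Rightarrow> nat list \<Rightarrow> bool" where
  "exponent_pattern C as \<longleftrightarrow>
     sorted_wrt (\<ge>) as \<and> (\<exists>ls. primary_decomposition C ls as)"

definition coprime_factors ::
    "('a, 'm) monoid_scheme \<Rightarrow> ('b, 'n) monoid_scheme \<Rightarrow> ('c, 'k) monoid_scheme \<Rightarrow> bool" where
  "coprime_factors A S C \<longleftrightarrow>
     finite_group A \<and> finite_group S \<and> finite_group C \<and>
     cyclic_group A \<and> squarefree (order A) \<and> cyclic_group C \<and>
     gcd (order A) (order S * order C) = 1 \<and> gcd (order S) (order C) = 1"

text \<open>The exponents of \<open>C\<close> do not depend on the chosen primary decomposition, up to order;
  the last two conjuncts say that one exists and that in each one all exponents are at least 2.\<close>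

definition threshold_decomposition ::
    "('a, 'm) monoid_scheme \<Rightarrow> ('b, 'n) monoid_scheme \<Rightarrow> ('c, 'k) monoid_scheme \<Rightarrow> bool" where
  "threshold_decomposition A S C \<longleftrightarrow>
     coprime_factors A S C \<and>
     (trivial_group S \<or> fundamental_block S) \<and>
     group_lambda S * group_delta C < 59 / 8 \<and>
     (\<exists>ls as. primary_decomposition C ls as) \<and>
     (\<forall>ls as. primary_decomposition C ls as \<longrightarrow> (\<forall>a \<in> set as. 2 \<le> a))"

definition threshold_patterns :: "nat list set" where
  "threshold_patterns =
     {[]} \<union>
     {[a] | a. 2 \<le> a \<and> a \<le> 13} \<union>
     {[a, b] | a b. a \<ge> b \<and> b \<ge> 2 \<and> (a + 1) * (b + 1) \<le> 29} \<union>
     {[a, 2, 2] | a. 2 \<le> a \<and> a \<le> 5} \<union> {[3, 3, 2]} \<union>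
     {[3, 2, 2, 2], [2, 2, 2, 2]}"

end

theory Submission
  imports Defs "HOL-Algebra.Multiplicative_Group" "HOL-Number_Theory.Cong"
begin

text \<open>
  For coprime orders every subgroup of a direct product is a product of subgroups, so
  \<open>\<lambda>\<close> is multiplicative; on cyclic groups it equals \<open>\<delta>\<close>, which is \<open>1\<close> in squarefree order and
  at least \<open>1\<close> always. To decompose \<open>G\<close>, choose a central element \<open>z\<close> whose order \<open>n\<close> is coprime to
  \<open>|G| / n\<close>, with \<open>n\<close> maximal. The transfer \<open>G \<rightarrow> \<langle>z\<rangle>\<close> restricts to the bijection
  \<open>x \<mapsto> x\<^bsup>|G|/n\<^esup>\<close> of \<open>\<langle>z\<rangle>\<close>, so its kernel \<open>S\<close> is a complement. Writing \<open>n = a c\<close> with \<open>a\<close> squarefree,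
  \<open>c\<close> powerful and \<open>a\<close>, \<open>c\<close> coprime gives \<open>\<langle>z\<rangle> = A \<times> C\<close>. A central cyclic Sylow subgroup of \<open>S\<close>, with generator
  \<open>x\<close>, would make \<open>z x\<close> a better choice than \<open>z\<close>.
\<close>

section \<open>Divisor counts and exponent patterns\<close>

lemma card_divisors_mult_coprime:
  fixes m n :: nat
  assumes "coprime m n"
  shows "card {k. k dvd m * n} = card {k. k dvd m} * card {k. k dvd n}"
proof -
  have "bij_betw (\<lambda>(a, b). a * b) ({k. k dvd m} \<times> {k. k dvd n}) {k. k dvd m * n}"
    unfolding bij_betw_def
  proof
    show "inj_on (\<lambda>(a, b). a * b) ({k. k dvd m} \<times> {k. k dvd n})"
    proof (rule inj_onI, clarsimp)
      fix a b a' b' assume *: "a dvd m" "b dvd n" "a' dvd m" "b' dvd n" and eq: "a * b = a' * b'"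
      have "coprime a b'" "coprime a' b"
        using * assms by (meson coprime_divisors)+
      then have "a = a'"
        using eq by (metis coprime_dvd_mult_left_iff dvd_antisym dvd_triv_left)
      moreover have "b = b'"
        using eq \<open>coprime a b'\<close> \<open>coprime a' b\<close>
        by (metis coprime_commute coprime_dvd_mult_right_iff dvd_antisym dvd_triv_right)
      ultimately show "a = a' \<and> b = b'" by simp
    qed
    show "(\<lambda>(a, b). a * b) ` ({k. k dvd m} \<times> {k. k dvd n}) = {k. k dvd m * n}"
    proof (intro equalityI subsetI)
      fix k assume "k \<in> {k. k dvd m * n}"
      then obtain a b where "k = a * b" "a dvd m" "b dvd n"
        using division_decomp by blast
      then show "k \<in> (\<lambda>(a, b). a * b) ` ({k. k dvd m} \<times> {k. k dvd n})" by auto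
    qed (auto intro: mult_dvd_mono)
  qed
  then show ?thesis
    by (metis bij_betw_same_card card_cartesian_product)
qed

lemma card_divisors_prime_power:
  fixes p :: nat
  assumes "prime p"
  shows "card {k. k dvd p ^ a} = a + 1"
proof -
  have "{k. k dvd p ^ a} = (\<lambda>i. p ^ i) ` {..a}"
    using assms by (auto simp: divides_primepow_nat)
  moreover have "inj_on (\<lambda>i. p ^ i) {..a}"
    using prime_gt_1_nat[OF assms] by (auto simp: inj_on_def)
  ultimately show ?thesis by (simp add: card_image)
qed

lemma card_divisors_prod_prime_powers:
  fixes f :: "nat \<Rightarrow> nat"
  assumes "finite L" "\<And>l. l \<in> L \<Longrightarrow> prime l"
  shows "card {k. k dvd (\<Prod>l\<in>L. l ^ f l)} = (\<Prod>l\<in>L. f l + 1)"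
  using assms
proof (induction L rule: finite_induct)
  case (insert p L)
  have "coprime (p ^ f p) (\<Prod>l\<in>L. l ^ f l)"
    using insert by (intro prod_coprime_right) (metis coprime_power_left_iff coprime_power_right_iff insertCI primes_coprime)
  then show ?case
    using insert by (simp add: card_divisors_mult_coprime card_divisors_prime_power)
qed simp

lemma card_divisors_eq:
  fixes n :: nat
  assumes "n > 0"
  shows "card {k. k dvd n} = (\<Prod>p\<in>prime_factors n. multiplicity p n + 1)"
proof -
  have "n = (\<Prod>p\<in>prime_factors n. p ^ multiplicity p n)"
    using assms by (rule prime_factorization_nat)
  then have "card {k. k dvd n} = card {k. k dvd (\<Prod>p\<in>prime_factors n. p ^ multiplicity p n)}"
    by simp
  also have "\<dots> = (\<Prod>p\<in>prime_factors n. multiplicity p n + 1)"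
    by (rule card_divisors_prod_prime_powers) auto
  finally show ?thesis .
qed

text \<open>Each prime factor contributes a factor of at least 2 to the divisor count. This gives
  \<delta> \<ge> 1; in the squarefree case every such factor is exactly 2.\<close>

lemma card_divisors_ge:
  fixes n :: nat
  assumes "n > 0"
  shows "2 ^ card (prime_factors n) \<le> card {k. k dvd n}"
proof -
  have "(\<Prod>p\<in>prime_factors n. 2) \<le> (\<Prod>p\<in>prime_factors n. multiplicity p n + 1)"
    by (rule prod_mono) (auto simp: prime_factors_multiplicity)
  then show ?thesis
    using assms by (simp add: card_divisors_eq)
qed

lemma card_divisors_squarefree:
  fixes n :: nat
  assumes "squarefree n"
  shows "card {k. k dvd n} = 2 ^ card (prime_factors n)"
proof -
  have n: "n > 0" using assms by (auto intro: gr0I)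
  then have "multiplicity p n = 1" if "p \<in> prime_factors n" for p
    using that assms by (auto simp: squarefree_factorial_semiring')
  then show ?thesis
    using n by (simp add: card_divisors_eq numeral_2_eq_2)
qed

lemma card_prime_factors_mult_coprime:
  fixes m n :: nat
  assumes "coprime m n" "m > 0" "n > 0"
  shows "card (prime_factors (m * n)) = card (prime_factors m) + card (prime_factors n)"
proof -
  have "prime_factors m \<inter> prime_factors n = {}"
    using assms(1) by (auto dest!: in_prime_factors_iff[THEN iffD1] dest: coprime_common_divisor not_prime_unit)
  then show ?thesis
    using assms by (simp add: prime_factors_product card_Un_disjoint)
qed

text \<open>Take \<open>a\<close> to be the largest squarefree divisor of \<open>n\<close> that is
  coprime to its cofactor \<open>c\<close>. A prime dividing \<open>c\<close> exactly once could be
  moved into \<open>a\<close>, giving a larger divisor of the same kind.\<close>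

lemma squarefree_powerful_split:
  fixes n :: nat
  assumes "n > 0"
  obtains a c where "n = a * c" "coprime a c" "squarefree a"
    "\<And>p. prime p \<Longrightarrow> p dvd c \<Longrightarrow> 2 \<le> multiplicity p c"
proof -
  define Q where "Q = (\<lambda>a. squarefree a \<and> a dvd n \<and> coprime a (n div a))"
  have "Q 1" by (simp add: Q_def)
  have bound: "a \<le> n" if "Q a" for a
    using that assms by (auto simp: Q_def dest: dvd_imp_le)
  define a where "a = Greatest Q"
  have a: "Q a" unfolding a_def by (rule GreatestI_nat[where P = Q, OF \<open>Q 1\<close> bound])
  have max: "b \<le> a" if "Q b" for b
    unfolding a_def by (rule Greatest_le_nat[where P = Q, OF that bound])
  obtain c where n: "n = a * c" using a by (auto simp: Q_def)
  have pos: "a > 0" "c > 0" using n assms by auto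
  have cop: "coprime a c" using a n pos by (simp add: Q_def)
  show ?thesis
  proof
    show "n = a * c" "coprime a c" by fact+
    show "squarefree a" using a by (simp add: Q_def)
    fix p :: nat assume p: "prime p" "p dvd c"
    show "2 \<le> multiplicity p c"
    proof (rule ccontr)
      assume "\<not> 2 \<le> multiplicity p c"
      moreover have "multiplicity p c > 0"
        using p pos by (simp add: prime_multiplicity_gt_zero_iff)
      ultimately have m: "multiplicity p c = 1" by simp
      obtain d where d: "c = p * d" using p by auto
      have "\<not> p dvd d"
      proof
        assume "p dvd d"
        then have "p ^ 2 dvd c" using d by (auto simp: power2_eq_square)
        then have "2 \<le> multiplicity p c"
          using p pos by (metis multiplicity_geI not_prime_unit not_gr_zero)
        with m show False by simp
      qed
      then have pd: "coprime p d" using p by (simp add: prime_imp_coprime)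
      have "Q (a * p)"
        unfolding Q_def
      proof (intro conjI)
        show "squarefree (a * p)"
          using a p cop d by (intro squarefree_mult_coprime) (auto simp: Q_def squarefree_prime)
        show "a * p dvd n" using n d by simp
        have "n div (a * p) = d" using n d pos p by (simp add: prime_gt_0_nat)
        then show "coprime (a * p) (n div (a * p))" using pd cop d by simp
      qed
      from max[OF this] pos prime_gt_1_nat[OF p(1)] show False by simp
    qed
  qed
qed

section \<open>Exponent lists below the threshold 59/8\<close>

lemma prod_list_half_threshold_iff:
  assumes "sorted_wrt (\<ge>) as" "\<forall>a\<in>set as. 2 \<le> a"
  shows "prod_list (map (\<lambda>a. (real a + 1) / 2) as) < 59 / 8 \<longleftrightarrow> as \<in> threshold_patterns"
proof -
  \<comment> \<open>The list is split by its length, because five entries are already too many: each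
    factor is at least 3/2, and (3/2)^5 = 243/32 exceeds 59/8 = 236/32.\<close>
  consider (0) "as = []" | (1) a where "as = [a]" | (2) a b where "as = [a, b]"
    | (3) a b c where "as = [a, b, c]" | (4) a b c d where "as = [a, b, c, d]"
    | (5) a b c d e xs where "as = a # b # c # d # e # xs"
    by (cases as; cases "tl as"; cases "tl (tl as)"; cases "tl (tl (tl as))"; cases "tl (tl (tl (tl as)))") auto
  then show ?thesis
  proof cases
    case 0 then show ?thesis by (simp add: threshold_patterns_def)
  next
    case 1
    \<comment> \<open>The inequality reads a + 1 < 59/4, that is, a \<le> 13.\<close>
    then show ?thesis using assms by (auto simp: threshold_patterns_def)
  next
    case 2
    have "prod_list (map (\<lambda>a. (real a + 1) / 2) as) = real ((a + 1) * (b + 1)) / 4"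
      using 2 by (simp add: algebra_simps)
    \<comment> \<open>The bound 59/2 is not an integer, so being below it means being at most
      29.\<close>
    moreover have "real ((a + 1) * (b + 1)) / 4 < 59 / 8 \<longleftrightarrow> (a + 1) * (b + 1) \<le> 29"
      by linarith
    ultimately show ?thesis using assms 2 by (simp add: threshold_patterns_def)
  next
    case 3
    have ord: "a \<ge> b" "b \<ge> c" "c \<ge> 2" using assms 3 by auto
    have "prod_list (map (\<lambda>a. (real a + 1) / 2) as) = real ((a + 1) * (b + 1) * (c + 1)) / 8"
      using 3 by (simp add: field_simps)
    moreover have "real X / 8 < 59 / 8 \<longleftrightarrow> X < 59" for X
      by linarith
    moreover have "(a + 1) * (b + 1) * (c + 1) < 59 \<longleftrightarrow> as \<in> threshold_patterns"
    proof
      assume lt: "(a + 1) * (b + 1) * (c + 1) < 59"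
      \<comment> \<open>The smallest entry must be 2, since three factors of at least 4 multiply to
        64 or more. With c = 2 the same comparison excludes b \<ge> 4, where the product is at least
        75.\<close>
      have "c < 3"
      proof (rule ccontr)
        assume "\<not> c < 3"
        then have "4 * 4 * 4 \<le> (a + 1) * (b + 1) * (c + 1)" using ord by (intro mult_le_mono) auto
        with lt show False by simp
      qed
      then have c: "c = 2" using ord by simp
      have "b < 4"
      proof (rule ccontr)
        assume "\<not> b < 4"
        then have "5 * 5 * 3 \<le> (a + 1) * (b + 1) * (c + 1)" using ord by (intro mult_le_mono) auto
        with lt show False by simp
      qed
      then have "b = 2 \<or> b = 3" using ord c by auto
      \<comment> \<open>For b = 2 the bound is 9 (a + 1) < 59, so a \<le> 5. For b = 3 it is 12 (a +
        1) < 59, which together with a \<ge> b leaves a = 3.\<close>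
      then show "as \<in> threshold_patterns" using lt c 3 ord by (auto simp: threshold_patterns_def)
    next
      assume "as \<in> threshold_patterns"
      then show "(a + 1) * (b + 1) * (c + 1) < 59"
        using 3 by (auto simp: threshold_patterns_def)
    qed
    ultimately show ?thesis by (simp only:)
  next
    case 4
    have ord: "a \<ge> b" "b \<ge> c" "c \<ge> d" "d \<ge> 2" using assms 4 by auto
    have "prod_list (map (\<lambda>a. (real a + 1) / 2) as)
        = real ((a + 1) * (b + 1) * (c + 1) * (d + 1)) / 16"
      using 4 by (simp add: field_simps)
    moreover have "real X / 16 < 59 / 8 \<longleftrightarrow> X < 118" for X
      by linarith
    moreover have "(a + 1) * (b + 1) * (c + 1) * (d + 1) < 118 \<longleftrightarrow> as \<in> threshold_patterns"
    proof
      assume lt: "(a + 1) * (b + 1) * (c + 1) * (d + 1) < 118"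
      \<comment> \<open>Otherwise the product is at least 144. Once the last three entries equal 2,
        the bound is 27 (a + 1) < 118, so a \<le> 3.\<close>
      have "b < 3"
      proof (rule ccontr)
        assume "\<not> b < 3"
        then have "4 * 4 * 3 * 3 \<le> (a + 1) * (b + 1) * (c + 1) * (d + 1)"
          using ord by (intro mult_le_mono) auto
        with lt show False by simp
      qed
      then have *: "b = 2" "c = 2" "d = 2" using ord by auto
      with lt have "a \<le> 3" by simp
      with * show "as \<in> threshold_patterns" using lt 4 ord by (auto simp: threshold_patterns_def)
    next
      assume "as \<in> threshold_patterns"
      then show "(a + 1) * (b + 1) * (c + 1) * (d + 1) < 118"
        using 4 by (auto simp: threshold_patterns_def)
    qed
    ultimately show ?thesis by (simp only:)
  next
    case 5
    have ge: "(3 / 2) ^ length xs \<le> prod_list (map (\<lambda>a. (real a + 1) / 2) xs)"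
      if "\<forall>a\<in>set xs. 2 \<le> a" for xs :: "nat list"
      using that
    proof (induction xs)
      case (Cons x xs)
      then show ?case by (auto intro!: mult_mono)
    qed simp
    have "(3 / 2) ^ 5 * 1 \<le> (3 / 2 :: real) ^ 5 * (3 / 2) ^ length xs"
      by (intro mult_left_mono one_le_power) auto
    also have "length as = 5 + length xs" using 5 by simp
    then have "(3 / 2 :: real) ^ 5 * (3 / 2) ^ length xs = (3 / 2) ^ length as" by (simp only: power_add)
    also have "\<dots> \<le> prod_list (map (\<lambda>a. (real a + 1) / 2) as)" using ge assms by blast
    finally have "\<not> prod_list (map (\<lambda>a. (real a + 1) / 2) as) < 59 / 8"
      by (simp add: power_divide)
    then show ?thesis using 5 by (auto simp: threshold_patterns_def)
  qed
qed

section \<open>Multiplicativity of the subgroup count\<close>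

lemma sub_count_iso:
  assumes "group G" "group H" "G \<cong> H"
  shows "sub_count G = sub_count H"
proof -
  obtain h where h: "h \<in> iso G H" using assms by (auto simp: is_iso_def)
  have bij: "bij_betw h (carrier G) (carrier H)" using h by (simp add: iso_def)
  define k where "k = inv_into (carrier G) h"
  have k: "k \<in> iso H G" unfolding k_def using assms(1) h by (rule group.iso_set_sym)
  interpret h: group_hom G H h
    using assms h by (simp add: group_hom_def group_hom_axioms_def iso_def)
  interpret k: group_hom H G k
    using assms k by (simp add: group_hom_def group_hom_axioms_def iso_def)
  have "bij_betw ((`) h) {K. subgroup K G} {K. subgroup K H}"
  proof (rule bij_betw_byWitness[where f' = "(`) k"])
    show "\<forall>K\<in>{K. subgroup K G}. k ` h ` K = K"
      using bij by (metis k_def bij_betw_def inv_into_image_cancel subgroup.subset mem_Collect_eq)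
    show "\<forall>K\<in>{K. subgroup K H}. h ` k ` K = K"
      using bij by (metis k_def bij_betw_def image_inv_into_cancel subgroup.subset mem_Collect_eq)
  qed (auto intro: h.subgroup_img_is_subgroup k.subgroup_img_is_subgroup)
  then show ?thesis unfolding sub_count_def by (rule bij_betw_same_card)
qed

lemma prime_count_iso: "G \<cong> H \<Longrightarrow> prime_count G = prime_count H"
  by (simp add: prime_count_def order_def iso_same_card)

lemma order_DirProd: "order (G \<times>\<times> H) = order G * order H"
  by (simp add: order_def card_cartesian_product)

lemma pow_DirProd: "(a, b) [^]\<^bsub>G \<times>\<times> H\<^esub> (n::nat) = (a [^]\<^bsub>G\<^esub> n, b [^]\<^bsub>H\<^esub> n)"
  by (induction n) (auto simp: nat_pow_def)

lemma finite_group_DirProd: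
  "finite_group G \<Longrightarrow> finite_group H \<Longrightarrow> finite_group (G \<times>\<times> H)"
  by (simp add: finite_group_def DirProd_group)

lemma finite_group_order_pos: "finite_group G \<Longrightarrow> order G > 0"
  by (simp add: finite_group_def group.is_monoid monoid.order_gt_0_iff_finite)

lemma (in group) subgroup_nat_pow_mem:
  "subgroup H G \<Longrightarrow> x \<in> H \<Longrightarrow> x [^] (n::nat) \<in> H"
  by (induction n) (auto intro: subgroup.one_closed subgroup.m_closed)


text \<open>The exponent \<open>k\<close> acts as a projector: raising to the power \<open>k\<close>
  fixes the elements of order dividing \<open>m\<close> and kills those of order dividing
  \<open>n\<close>. It comes from the Chinese remainder theorem.\<close>

lemma coprime_exponent:
  fixes m n :: nat
  assumes "coprime m n"
  obtains k where "n dvd k" "[k = 1] (mod m)"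
  using assms binary_chinese_remainder_nat[of m n 1 0] by (auto simp: cong_0_iff)

lemma (in group) pow_cong_order:
  assumes "x \<in> carrier G" "[i = j] (mod order G)"
  shows "x [^] i = x [^] (j::nat)"
proof -
  have "x [^] k = x [^] (k mod order G)" for k
  proof -
    have "x [^] k = x [^] (order G * (k div order G) + k mod order G)" by simp
    also have "\<dots> = x [^] (k mod order G)"
      using assms(1) by (simp only: nat_pow_mult[symmetric] nat_pow_pow[symmetric] pow_order_eq_1 nat_pow_one) simp
    finally show ?thesis .
  qed
  then show ?thesis using assms(2) by (metis cong_def)
qed

text \<open>An exponent that is 1 modulo one order and 0 modulo the other turns
  \<open>(a, b)\<close> into \<open>(a, \<one>)\<close> or into \<open>(\<one>, b)\<close>. So
  \<open>K\<close> contains both components of each of its elements, hence every combination of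
  them.\<close>

lemma subgroup_DirProd_coprime:
  assumes "group G" "group H" "coprime (order G) (order H)" "subgroup K (G \<times>\<times> H)"
  shows "subgroup (fst ` K) G" "subgroup (snd ` K) H" "K = fst ` K \<times> snd ` K"
proof -
  interpret G: group G by fact
  interpret H: group H by fact
  interpret D: group "G \<times>\<times> H" by (rule DirProd_group) fact+
  interpret f: group_hom "G \<times>\<times> H" G fst
    by unfold_locales (auto simp: hom_def DirProd_def)
  interpret s: group_hom "G \<times>\<times> H" H snd
    by unfold_locales (auto simp: hom_def DirProd_def)
  show "subgroup (fst ` K) G" by (rule f.subgroup_img_is_subgroup) fact
  show "subgroup (snd ` K) H" by (rule s.subgroup_img_is_subgroup) fact
  have sub: "K \<subseteq> carrier G \<times> carrier H" using subgroup.subset[OF assms(4)] by simp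
  show "K = fst ` K \<times> snd ` K"
  proof (intro equalityI subsetI)
    fix z assume "z \<in> fst ` K \<times> snd ` K"
    then obtain a b c d where z: "z = (a, d)" and ab: "(a, b) \<in> K" and cd: "(c, d) \<in> K" by force
    obtain i where i: "order H dvd i" "[i = 1] (mod order G)"
      using coprime_exponent assms(3) by blast
    obtain j where j: "order G dvd j" "[j = 1] (mod order H)"
      using coprime_exponent assms(3) by (metis coprime_commute)
    have mem: "a \<in> carrier G" "c \<in> carrier G" "b \<in> carrier H" "d \<in> carrier H" using ab cd sub by auto
    have "(a, b) [^]\<^bsub>G \<times>\<times> H\<^esub> i \<in> K" "(c, d) [^]\<^bsub>G \<times>\<times> H\<^esub> j \<in> K"
      using ab cd assms(4) by (auto intro: D.subgroup_nat_pow_mem)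
    moreover have "a [^]\<^bsub>G\<^esub> i = a" "d [^]\<^bsub>H\<^esub> j = d"
      using G.pow_cong_order[OF _ i(2)] H.pow_cong_order[OF _ j(2)] mem by auto
    moreover have "b [^]\<^bsub>H\<^esub> i = \<one>\<^bsub>H\<^esub>" "c [^]\<^bsub>G\<^esub> j = \<one>\<^bsub>G\<^esub>"
      using G.pow_cong_order[of c j 0] H.pow_cong_order[of b i 0] mem i j by (auto simp: cong_0_iff)
    ultimately have "(a, \<one>\<^bsub>H\<^esub>) \<in> K" "(\<one>\<^bsub>G\<^esub>, d) \<in> K"
      by (auto simp: pow_DirProd)
    then have "(a, \<one>\<^bsub>H\<^esub>) \<otimes>\<^bsub>G \<times>\<times> H\<^esub> (\<one>\<^bsub>G\<^esub>, d) \<in> K"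
      using assms(4) by (blast intro: subgroup.m_closed)
    then show "z \<in> K" using mem z by simp
  qed force
qed

lemma sub_count_DirProd_coprime:
  assumes "group G" "group H" "coprime (order G) (order H)"
  shows "sub_count (G \<times>\<times> H) = sub_count G * sub_count H"
proof -
  have "bij_betw (\<lambda>(A, B). A \<times> B) ({K. subgroup K G} \<times> {K. subgroup K H}) {K. subgroup K (G \<times>\<times> H)}"
  proof (rule bij_betw_byWitness[where f' = "\<lambda>K. (fst ` K, snd ` K)"])
    show "\<forall>P\<in>{K. subgroup K G} \<times> {K. subgroup K H}.
        (fst ` (case P of (A, B) \<Rightarrow> A \<times> B), snd ` (case P of (A, B) \<Rightarrow> A \<times> B)) = P"
      by (auto dest: subgroup.one_closed)
    show "\<forall>K\<in>{K. subgroup K (G \<times>\<times> H)}. (case (fst ` K, snd ` K) of (A, B) \<Rightarrow> A \<times> B) = K"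
      using subgroup_DirProd_coprime(3)[OF assms] by auto
    show "(\<lambda>(A, B). A \<times> B) ` ({K. subgroup K G} \<times> {K. subgroup K H}) \<subseteq> {K. subgroup K (G \<times>\<times> H)}"
      using assms by (auto intro: DirProd_subgroups)
    show "(\<lambda>K. (fst ` K, snd ` K)) ` {K. subgroup K (G \<times>\<times> H)} \<subseteq> {K. subgroup K G} \<times> {K. subgroup K H}"
      using subgroup_DirProd_coprime(1,2)[OF assms] by auto
  qed
  then show ?thesis
    unfolding sub_count_def by (metis bij_betw_same_card card_cartesian_product)
qed

lemma group_lambda_DirProd_coprime:
  assumes "finite_group G" "finite_group H" "coprime (order G) (order H)"
  shows "group_lambda (G \<times>\<times> H) = group_lambda G * group_lambda H"
  using assms finite_group_order_pos[OF assms(1)] finite_group_order_pos[OF assms(2)]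
  by (simp add: group_lambda_def prime_count_def order_DirProd card_prime_factors_mult_coprime
      sub_count_DirProd_coprime finite_group_def power_add)

section \<open>Finite cyclic groups: isomorphism type and subgroup count\<close>

lemma (in group) ord_generator:
  assumes "x \<in> carrier G" "subgroup_generated G {x} = G"
  shows "ord x = order G"
  using cyclic_order_is_ord[OF assms(1)] assms(2) by simp

lemma (in group) cyclic_iso_integer_mod_group:
  assumes "cyclic_group G" "finite (carrier G)"
  shows "integer_mod_group (order G) \<cong> G"
proof -
  obtain x where x: "x \<in> carrier G" and gen: "subgroup_generated G {x} = G"
    using assms by (auto simp: cyclic_group_def)
  have ord: "ord x = order G" using x gen by (rule ord_generator)
  have pos: "order G > 0" using assms by (simp add: order_gt_0_iff_finite)
  have "(\<lambda>i::int. x [^] i) \<in> iso (integer_mod_group (order G)) G"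
    unfolding iso_def
  proof (intro CollectI conjI)
    show "(\<lambda>i::int. x [^] i) \<in> hom (integer_mod_group (order G)) G"
    proof (rule homI)
      fix i j :: int
      have "x [^] ((i + j) mod int (order G)) = x [^] (i + j)"
        using x ord by (simp add: int_pow_eq mod_eq_dvd_iff[symmetric])
      then show "x [^] (i \<otimes>\<^bsub>integer_mod_group (order G)\<^esub> j) = x [^] i \<otimes> x [^] j"
        using x by (simp add: int_pow_mult)
    qed (use x in auto)
    have inj: "inj_on (\<lambda>i::int. x [^] i) {0..<int (order G)}"
    proof (rule inj_onI)
      fix i j :: int
      assume "i \<in> {0..<int (order G)}" "j \<in> {0..<int (order G)}" "x [^] i = x [^] j"
      then have "i mod int (order G) = j mod int (order G)"
        using x ord by (metis int_pow_eq mod_eq_dvd_iff)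
      then show "i = j" using \<open>i \<in> _\<close> \<open>j \<in> _\<close> by simp
    qed
    \<comment> \<open>Surjectivity follows from injectivity, both sides having
      \<open>order G\<close> elements.\<close>
    moreover have "(\<lambda>i::int. x [^] i) ` {0..<int (order G)} = carrier G"
      by (rule card_subset_eq) (use x assms inj in \<open>auto simp: card_image order_def\<close>)
    ultimately show "bij_betw (\<lambda>i::int. x [^] i) (carrier (integer_mod_group (order G))) (carrier G)"
      using pos by (simp add: bij_betw_def carrier_integer_mod_group)
  qed
  then show ?thesis by (rule is_isoI)
qed

lemma cyclic_groups_iso:
  assumes "finite_group G" "cyclic_group G" "finite_group H" "cyclic_group H" "order G = order H"
  shows "G \<cong> H"
proof -
  have "integer_mod_group (order G) \<cong> G" "integer_mod_group (order G) \<cong> H"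
    using assms group.cyclic_iso_integer_mod_group by (metis finite_group_def)+
  then show ?thesis
    by (meson group.iso_sym group_integer_mod_group iso_trans)
qed

text \<open>If \<open>x\<close> generates \<open>G\<close> and |G| = d e, then the solutions of y^d
  = 1 are precisely the powers of x^e, an element of order d.\<close>

lemma (in group) card_pow_eq_one_cyclic:
  assumes "cyclic_group G" "finite (carrier G)" "d dvd order G"
  shows "card {y \<in> carrier G. y [^] d = \<one>} = d"
proof -
  obtain x where x: "x \<in> carrier G" and gen: "subgroup_generated G {x} = G"
    using assms by (auto simp: cyclic_group_def)
  have ord: "ord x = order G" using x gen by (rule ord_generator)
  have pos: "order G > 0" using assms by (simp add: order_gt_0_iff_finite)
  obtain e where e: "order G = d * e" using assms(3) by auto
  with pos have pos': "d > 0" "e > 0" by auto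
  have carr: "carrier G = range (\<lambda>k::nat. x [^] k)"
  proof -
    have "carrier G = generate G {x}"
      using gen x by (metis carrier_subgroup_generated Int_absorb1 empty_subsetI insert_subset)
    then show ?thesis using generate_pow_on_finite_carrier[OF assms(2) x] by (simp add: full_SetCompr_eq)
  qed
  have "{y \<in> carrier G. y [^] d = \<one>} = range (\<lambda>k::nat. (x [^] e) [^] k)"
  proof (intro equalityI subsetI)
    fix y assume "y \<in> {y \<in> carrier G. y [^] d = \<one>}"
    then obtain k :: nat where k: "y = x [^] k" "x [^] (k * d) = \<one>"
      using carr x by (auto simp: nat_pow_pow)
    then have "d * e dvd k * d" using x ord e by (simp add: pow_eq_id)
    then have "e dvd k" using pos' by (simp add: mult.commute)
    then show "y \<in> range (\<lambda>k::nat. (x [^] e) [^] k)"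
      using k x by (auto simp: nat_pow_pow)
  next
    fix y assume "y \<in> range (\<lambda>k::nat. (x [^] e) [^] k)"
    then obtain k :: nat where k: "y = x [^] (e * k)" using x by (auto simp: nat_pow_pow)
    have "ord x dvd e * k * d" using ord e by (simp add: mult.commute mult.left_commute)
    then have "y [^] d = \<one>" using k x by (simp add: nat_pow_pow pow_eq_id)
    then show "y \<in> {y \<in> carrier G. y [^] d = \<one>}" using k x by simp
  qed
  also have "\<dots> = generate G {x [^] e}"
    using generate_pow_on_finite_carrier[OF assms(2), of "x [^] e"] x by (simp add: full_SetCompr_eq)
  also have "card \<dots> = ord (x [^] e)"
    using x by (simp add: generate_pow_card)
  also have "\<dots> = d" using x e ord pos' by (simp add: ord_pow)
  finally show ?thesis .
qed

text \<open>The only subgroup of order d is the solution set \<open>R d\<close> of y^d = 1: by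
  Lagrange a subgroup \<open>K\<close> lies in \<open>R (card K)\<close>, and both have the same
  size. So \<open>card\<close> and \<open>R\<close> are mutually inverse.\<close>

lemma sub_count_cyclic:
  fixes G (structure)
  assumes "finite_group G" "cyclic_group G"
  shows "sub_count G = card {k. k dvd order G}"
proof -
  interpret group G using assms by (simp add: finite_group_def)
  interpret comm_group G using assms(2) by (rule cyclic_imp_abelian_group)
  have fin: "finite (carrier G)" using assms by (simp add: finite_group_def)
  define R where "R = (\<lambda>d. {y \<in> carrier G. y [^] (d::nat) = \<one>})"
  have sub: "subgroup (R d) G" for d
    unfolding R_def by (rule subgroupI) (auto simp: pow_mult_distrib m_comm nat_pow_inv)
  have card: "card (R d) = d" if "d dvd order G" for d
    using card_pow_eq_one_cyclic assms fin that by (simp add: R_def)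
  have "bij_betw card {K. subgroup K G} {k. k dvd order G}"
  proof (rule bij_betw_byWitness[where f' = R])
    show "\<forall>K\<in>{K. subgroup K G}. R (card K) = K"
    proof clarify
      fix K assume K: "subgroup K G"
      have dvd: "card K dvd order G" using lagrange[OF K] by (metis dvd_triv_right)
      have "K \<subseteq> R (card K)"
      proof
        fix y assume y: "y \<in> K"
        interpret K: group "G\<lparr>carrier := K\<rparr>" using K by (rule subgroup.subgroup_is_group) (rule group_axioms)
        have "y [^]\<^bsub>G\<lparr>carrier := K\<rparr>\<^esub> order (G\<lparr>carrier := K\<rparr>) = \<one>\<^bsub>G\<lparr>carrier := K\<rparr>\<^esub>"
          using y by (intro K.pow_order_eq_1) simp
        then show "y \<in> R (card K)"
          using y subgroup.subset[OF K] by (auto simp: R_def order_def nat_pow_consistent[symmetric])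
      qed
      then show "R (card K) = K"
        using card[OF dvd] card_subset_eq[of "R (card K)" K] fin by (simp add: R_def)
    qed
    show "\<forall>k\<in>{k. k dvd order G}. card (R k) = k" using card by simp
    show "card ` {K. subgroup K G} \<subseteq> {k. k dvd order G}"
      by (auto simp: lagrange[symmetric])
    show "R ` {k. k dvd order G} \<subseteq> {K. subgroup K G}" using sub by auto
  qed
  then show ?thesis unfolding sub_count_def by (rule bij_betw_same_card)
qed

section \<open>Values of \<lambda> and \<delta>, and the threshold in terms of \<lambda>\<close>

lemma group_lambda_cyclic:
  "finite_group G \<Longrightarrow> cyclic_group G \<Longrightarrow> group_lambda G = group_delta G"
  by (simp add: group_lambda_def group_delta_def sub_count_cyclic)

lemma group_delta_ge_1: "finite_group G \<Longrightarrow> group_delta G \<ge> 1"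
  using card_divisors_ge[OF finite_group_order_pos, of G]
  by (simp add: group_delta_def prime_count_def of_nat_le_iff[symmetric] del: of_nat_le_iff)

lemma group_delta_squarefree: "squarefree (order G) \<Longrightarrow> group_delta G = 1"
  by (simp add: group_delta_def prime_count_def card_divisors_squarefree)

lemma group_lambda_trivial:
  assumes "trivial_group G"
  shows "group_lambda G = 1"
proof -
  have "finite_group G" "cyclic_group G" "order G = 1"
    using assms trivial_imp_cyclic_group by (auto simp: trivial_group_def finite_group_def order_def)
  then show ?thesis by (simp add: group_lambda_cyclic group_delta_squarefree)
qed

text \<open>By coprimality \<lambda> splits into three factors. The one from \<open>A\<close> is 1
  because |A| is squarefree, and the one from the cyclic group \<open>C\<close> is
  \<delta>(C).\<close>

lemma coprime_factors_lambda:
  assumes "coprime_factors A S C"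
  shows "group_lambda (A \<times>\<times> S \<times>\<times> C) = group_lambda S * group_delta C"
  using assms
  by (simp add: coprime_factors_def group_lambda_DirProd_coprime finite_group_DirProd order_DirProd
      group_lambda_cyclic group_delta_squarefree coprime_iff_gcd_eq_1)

text \<open>Multiplying by 2^\<pi>(G) and absorbing the denominator 8 = 2^3 gives the exponent
  \<pi>(G) - 3. The integer power \<open>powi\<close> allows for groups with fewer than three prime
  divisors, where this exponent is negative.\<close>

lemma group_lambda_less_iff:
  "group_lambda G < 59 / 8 \<longleftrightarrow> real (sub_count G) < 59 * 2 powi (int (prime_count G) - 3)"
proof -
  have "2 powi (int (prime_count G) - 3) = (2::real) ^ prime_count G / 8"
    by (simp add: power_int_diff)
  then have "59 * 2 powi (int (prime_count G) - 3) = 59 / 8 * (2::real) ^ prime_count G"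
    by simp
  then show ?thesis by (simp only: group_lambda_def pos_divide_less_eq zero_less_power zero_less_numeral)
qed

section \<open>Complements of central Hall subgroups\<close>

text \<open>This is the transfer into a central subgroup, built from representatives
  \<open>r c\<close> of the right cosets. The element \<open>h c g\<close> of \<open>P\<close>
  measures how far \<open>r c \<otimes> g\<close> is from the representative of its coset, and
  \<open>f g\<close> is the product of these elements over all cosets.\<close>

lemma (in group) central_transfer:
  assumes fin: "finite (carrier G)" and P: "subgroup P G"
    and central: "\<And>z g. z \<in> P \<Longrightarrow> g \<in> carrier G \<Longrightarrow> z \<otimes> g = g \<otimes> z"
  obtains f where "f \<in> hom G (G\<lparr>carrier := P\<rparr>)" "\<And>z. z \<in> P \<Longrightarrow> f z = z [^] card (rcosets P)"
proof -
  have P_sub: "P \<subseteq> carrier G" using P by (rule subgroup.subset)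
  interpret P: group "G\<lparr>carrier := P\<rparr>"
    using P by (rule subgroup.subgroup_is_group) (rule group_axioms)
  \<comment> \<open>Centrality makes \<open>P\<close> abelian, so the product over the unordered set
    of cosets makes sense.\<close>
  interpret P: comm_group "G\<lparr>carrier := P\<rparr>"
    using central P_sub by (intro P.group_comm_groupI) auto
  define r where "r = (\<lambda>c :: 'a set. SOME x. x \<in> c)"
  define h where "h = (\<lambda>c g. r c \<otimes> g \<otimes> inv (r (c #> g)))"
  define f where "f = (\<lambda>g. finprod (G\<lparr>carrier := P\<rparr>) (\<lambda>c. h c g) (rcosets P))"
  have coset: "r c \<in> carrier G" "c = P #> r c" if c: "c \<in> rcosets P" for c
  proof -
    obtain a where a: "a \<in> carrier G" "c = P #> a" using c by (auto simp: RCOSETS_def)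
    then have "a \<in> c" using P by (simp add: rcos_self)
    then have rc: "r c \<in> c" unfolding r_def by (rule someI)
    show "r c \<in> carrier G" using rc a P_sub r_coset_subset_G by blast
    show "c = P #> r c" using repr_independence[OF _ a(1) P] rc a(2) by simp
  qed
  have closed: "c #> g \<in> rcosets P" if "c \<in> rcosets P" "g \<in> carrier G" for c g
    using that coset[OF that(1)] P_sub by (metis coset_mult_assoc m_closed rcosetsI)
  have r_split: "r c \<otimes> g = h c g \<otimes> r (c #> g)" and h_mem: "h c g \<in> P"
    if c: "c \<in> rcosets P" and g: "g \<in> carrier G" for c g
  proof -
    note c' = closed[OF c g]
    have mem: "r c \<in> carrier G" "r (c #> g) \<in> carrier G" using coset(1) c c' by auto
    show eq: "r c \<otimes> g = h c g \<otimes> r (c #> g)"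
      using mem g by (simp add: h_def m_assoc)
    have "c #> g = P #> (r c \<otimes> g)" using coset(2)[OF c] mem g P_sub by (metis coset_mult_assoc)
    then have "r c \<otimes> g \<in> P #> r (c #> g)"
      using rcos_self[OF _ P] mem g coset(2)[OF c'] by (metis m_closed)
    then obtain p where "p \<in> P" "r c \<otimes> g = p \<otimes> r (c #> g)" by (auto simp: r_coset_def)
    then show "h c g \<in> P" using mem g P_sub by (auto simp: h_def m_assoc)
  qed
  \<comment> \<open>Moving \<open>r c\<close> by \<open>g\<close> and then by \<open>g'\<close>
    reaches the same representative as moving it by \<open>g \<otimes> g'\<close>. Comparing the two
    expressions yields the cocycle identity.\<close>
  have cocycle: "h c (g \<otimes> g') = h c g \<otimes> h (c #> g) g'"
    if c: "c \<in> rcosets P" and g: "g \<in> carrier G" "g' \<in> carrier G" for c g g'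
  proof -
    have c1: "c #> g \<in> rcosets P" and c2: "c #> g #> g' \<in> rcosets P" using closed c g by auto
    have "c \<subseteq> carrier G" using coset[OF c] P_sub r_coset_subset_G by metis
    then have eq: "c #> (g \<otimes> g') = c #> g #> g'" using g by (simp add: coset_mult_assoc)
    have mem: "h c g \<in> carrier G" "h (c #> g) g' \<in> carrier G" "h c (g \<otimes> g') \<in> carrier G"
      using h_mem c c1 g P_sub by blast+
    have rmem: "r c \<in> carrier G" "r (c #> g) \<in> carrier G" "r (c #> g #> g') \<in> carrier G"
      using coset(1) c c1 c2 by auto
    have "h c (g \<otimes> g') \<otimes> r (c #> g #> g') = r c \<otimes> g \<otimes> g'"
      using r_split[OF c, of "g \<otimes> g'"] g rmem eq by (simp add: m_assoc)
    also have "\<dots> = h c g \<otimes> (r (c #> g) \<otimes> g')"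
      using r_split[OF c g(1)] g mem rmem by (simp add: m_assoc)
    also have "\<dots> = h c g \<otimes> h (c #> g) g' \<otimes> r (c #> g #> g')"
      using r_split[OF c1 g(2)] g mem rmem by (simp add: m_assoc)
    finally show ?thesis using mem rmem by simp
  qed
  show ?thesis
  proof
    show "f \<in> hom G (G\<lparr>carrier := P\<rparr>)"
    proof (rule homI)
      fix g assume "g \<in> carrier G"
      then show "f g \<in> carrier (G\<lparr>carrier := P\<rparr>)"
        unfolding f_def using h_mem by (intro P.finprod_closed) auto
    next
      fix g g' assume g: "g \<in> carrier G" and g': "g' \<in> carrier G"
      \<comment> \<open>Right multiplication by \<open>g\<close> permutes the cosets, so the second
        factor of the cocycle can be reindexed and its product is \<open>f g'\<close>.\<close>
      have inj: "inj_on (\<lambda>c. c #> g) (rcosets P)"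
      proof (rule inj_on_inverseI)
        fix c assume c: "c \<in> rcosets P"
        have "c \<subseteq> carrier G" using coset[OF c] P_sub r_coset_subset_G by metis
        then show "c #> g #> inv g = c" using g by (simp add: coset_mult_assoc)
      qed
      have fin': "finite (rcosets P)"
        using fin P by (meson finite_Pow_iff finite_subset rcosets_subset_PowG)
      have img: "(\<lambda>c. c #> g) ` (rcosets P) = rcosets P"
        by (rule endo_inj_surj[OF fin' _ inj]) (use closed g in auto)
      have "f (g \<otimes> g') = finprod (G\<lparr>carrier := P\<rparr>) (\<lambda>c. h c g \<otimes> h (c #> g) g') (rcosets P)"
        unfolding f_def using cocycle g g' h_mem closed P
        by (intro P.finprod_cong') (auto intro: subgroup.m_closed)
      also have "\<dots> = f g \<otimes> finprod (G\<lparr>carrier := P\<rparr>) (\<lambda>c. h (c #> g) g') (rcosets P)"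
        unfolding f_def
        using P.finprod_multf[of "\<lambda>c. h c g" "rcosets P" "\<lambda>c. h (c #> g) g'"] h_mem closed g g'
        by auto
      also have "finprod (G\<lparr>carrier := P\<rparr>) (\<lambda>c. h (c #> g) g') (rcosets P) = f g'"
        unfolding f_def
        using P.finprod_reindex[of "\<lambda>c. h c g'" "\<lambda>c. c #> g" "rcosets P"] inj img h_mem g' by auto
      finally show "f (g \<otimes> g') = f g \<otimes>\<^bsub>G\<lparr>carrier := P\<rparr>\<^esub> f g'" by simp
    qed
  next
    fix z assume z: "z \<in> P"
    \<comment> \<open>A central \<open>z\<close> in \<open>P\<close> fixes every coset, so each of
      the cosets contributes \<open>z\<close> itself.\<close>
    have "h c z = z" if c: "c \<in> rcosets P" for c
    proof -
      have rc: "r c \<in> carrier G" "c = P #> r c" using coset[OF c] by auto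
      have zc: "z \<in> carrier G" using z P_sub by auto
      have "c #> z = P #> (z \<otimes> r c)"
        using rc zc P_sub central[OF z rc(1)] by (metis coset_mult_assoc)
      also have "\<dots> = c"
        using rc zc P_sub P z by (metis coset_mult_assoc coset_join2)
      finally show ?thesis
        using rc zc central[OF z rc(1)] by (simp add: h_def) (metis inv_solve_right' m_closed)
    qed
    then have "f z = finprod (G\<lparr>carrier := P\<rparr>) (\<lambda>c. z) (rcosets P)"
      unfolding f_def using z by (intro P.finprod_cong') auto
    also have "\<dots> = z [^] card (rcosets P)"
      using z P.finprod_const[of z "rcosets P"] by (simp add: nat_pow_consistent[symmetric])
    finally show "f z = z [^] card (rcosets P)" .
  qed
qed

text \<open>The complement is the kernel of the transfer \<open>f\<close>. On \<open>P\<close> the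
  map \<open>f\<close> is the power map with exponent m = [G:P]; as m is coprime to |P|, this is a
  bijection of \<open>P\<close>. Hence the kernel meets \<open>P\<close> trivially, and every value
  of \<open>f\<close> is attained on \<open>P\<close>.\<close>

lemma (in group) central_Hall_complement:
  assumes fin: "finite (carrier G)" and P: "subgroup P G"
    and central: "\<And>z g. z \<in> P \<Longrightarrow> g \<in> carrier G \<Longrightarrow> z \<otimes> g = g \<otimes> z"
    and Hall: "coprime (card P) (order G div card P)"
  obtains K where "subgroup K G" "K \<inter> P = {\<one>}" "\<And>g. g \<in> carrier G \<Longrightarrow> \<exists>p\<in>P. \<exists>k\<in>K. g = p \<otimes> k"
proof -
  define m where "m = card (rcosets P)"
  obtain f where f: "f \<in> hom G (G\<lparr>carrier := P\<rparr>)" and fP: "\<And>z. z \<in> P \<Longrightarrow> f z = z [^] m"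
    using central_transfer[OF fin P central] unfolding m_def by blast
  have P_sub: "P \<subseteq> carrier G" using P by (rule subgroup.subset)
  interpret P: group "G\<lparr>carrier := P\<rparr>"
    using P by (rule subgroup.subgroup_is_group) (rule group_axioms)
  interpret f: group_hom G "G\<lparr>carrier := P\<rparr>" f
    by unfold_locales (rule f)
  have "card P > 0" using P fin by (rule subgroup.finite_imp_card_positive)
  moreover have "m * card P = order G" unfolding m_def using P by (rule lagrange)
  ultimately have "coprime (card P) m" using Hall by (metis nonzero_mult_div_cancel_right not_gr_zero)
  then obtain s where s: "m dvd s" "[s = 1] (mod card P)"
    using coprime_exponent by blast
  then obtain t where t: "s = m * t" by auto
  \<comment> \<open>The exponent \<open>t\<close> inverts \<open>m\<close> modulo |P|, so the power
    map with exponent \<open>t\<close> undoes \<open>f\<close> on \<open>P\<close>.\<close>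
  have pow: "(z [^] m) [^] t = z" if z: "z \<in> P" for z
  proof -
    have "z [^]\<^bsub>G\<lparr>carrier := P\<rparr>\<^esub> s = z [^]\<^bsub>G\<lparr>carrier := P\<rparr>\<^esub> (1::nat)"
      using z s(2) by (intro P.pow_cong_order) (auto simp: order_def)
    then show ?thesis
      using z P_sub t by (auto simp: nat_pow_consistent[symmetric] nat_pow_pow)
  qed
  define K where "K = kernel G (G\<lparr>carrier := P\<rparr>) f"
  show ?thesis
  proof
    show "subgroup K G" unfolding K_def by (rule f.subgroup_kernel)
    show "K \<inter> P = {\<one>}"
    proof (intro equalityI subsetI)
      fix x assume "x \<in> K \<inter> P"
      then have "x \<in> P" "x [^] m = \<one>" using fP by (auto simp: K_def kernel_def)
      with pow[of x] show "x \<in> {\<one>}" by simp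
    next
      fix x assume "x \<in> {\<one>}"
      then show "x \<in> K \<inter> P"
        using P f.hom_one by (auto simp: K_def kernel_def intro: subgroup.one_closed)
    qed
    fix g assume g: "g \<in> carrier G"
    \<comment> \<open>This is the element of \<open>P\<close> with the same image as
      \<open>g\<close>; dividing it out leaves an element of the kernel.\<close>
    define p where "p = f g [^] t"
    have fg: "f g \<in> P" using g f.hom_closed by simp
    then have p: "p \<in> P" unfolding p_def using P by (rule subgroup_nat_pow_mem[rotated])
    have pc: "p \<in> carrier G" using p P_sub by auto
    have "f p = f g" using p fP[OF p] pow[OF fg] fg P_sub unfolding p_def
      by (metis nat_pow_pow mult.commute subsetD)
    then have "f (inv p \<otimes> g) = \<one>"
      using g pc fg f.hom_inv[OF pc] P.l_inv[of "f g"] f.hom_mult[of "inv p" g] by simp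
    then have "inv p \<otimes> g \<in> K" using g pc by (simp add: K_def kernel_def)
    moreover have "g = p \<otimes> (inv p \<otimes> g)" using g pc by (simp add: m_assoc[symmetric])
    ultimately show "\<exists>p\<in>P. \<exists>k\<in>K. g = p \<otimes> k" using p by blast
  qed
qed

text \<open>If d is the order of x y, then x^(d k) y^(d k) = 1 for all k. Choosing k = ord y removes
  the second factor, so ord x divides d ord y and, by coprimality, d. The argument for ord y is
  symmetric.\<close>

lemma (in group) ord_mult_coprime:
  assumes "x \<in> carrier G" "y \<in> carrier G" "x \<otimes> y = y \<otimes> x" "coprime (ord x) (ord y)"
  shows "ord (x \<otimes> y) = ord x * ord y"
proof (rule dvd_antisym)
  show "ord (x \<otimes> y) dvd ord x * ord y" using assms(3,1,2) by (rule ord_mul_divides)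
  define d where "d = ord (x \<otimes> y)"
  have one: "x [^] (d * k) \<otimes> y [^] (d * k) = \<one>" for k
  proof -
    have "x [^] (d * k) \<otimes> y [^] (d * k) = (x \<otimes> y) [^] (d * k)"
      using assms(3,1,2) by (rule pow_mult_distrib[symmetric])
    also have "\<dots> = \<one>" using assms pow_eq_id[of "x \<otimes> y" "d * k"] by (simp add: d_def)
    finally show ?thesis .
  qed
  have "y [^] (d * ord y) = \<one>" "x [^] (d * ord x) = \<one>"
    using assms by (auto simp: pow_eq_id)
  then have "x [^] (d * ord y) = \<one>" "y [^] (d * ord x) = \<one>"
    using one[of "ord y"] one[of "ord x"] assms by auto
  then have "ord x dvd d * ord y" "ord y dvd d * ord x" using assms by (auto simp: pow_eq_id)
  then have "ord x dvd d" "ord y dvd d"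
    using assms(4) by (auto simp: coprime_dvd_mult_left_iff coprime_commute)
  then show "ord x * ord y dvd ord (x \<otimes> y)"
    using assms(4) by (simp add: d_def divides_mult)
qed

text \<open>The centralizer of \<open>g\<close> is a subgroup containing \<open>z\<close>, hence all
  of \<open>generate G {z}\<close>.\<close>

lemma (in group) generate_central:
  assumes "z \<in> carrier G" "\<And>g. g \<in> carrier G \<Longrightarrow> z \<otimes> g = g \<otimes> z"
    and "p \<in> generate G {z}" "g \<in> carrier G"
  shows "p \<otimes> g = g \<otimes> p"
proof -
  have "subgroup {x \<in> carrier G. x \<otimes> g = g \<otimes> x} G"
  proof (rule subgroupI)
    fix x y assume x: "x \<in> {x \<in> carrier G. x \<otimes> g = g \<otimes> x}" and y: "y \<in> {x \<in> carrier G. x \<otimes> g = g \<otimes> x}"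
    then show "x \<otimes> y \<in> {x \<in> carrier G. x \<otimes> g = g \<otimes> x}"
      using assms by simp (metis m_assoc)
  next
    fix x assume x: "x \<in> {x \<in> carrier G. x \<otimes> g = g \<otimes> x}"
    then show "inv x \<in> {x \<in> carrier G. x \<otimes> g = g \<otimes> x}"
      using assms by simp (metis inv_solve_left inv_solve_right m_assoc m_closed inv_closed)
  qed (use assms in auto)
  then have "generate G {z} \<subseteq> {x \<in> carrier G. x \<otimes> g = g \<otimes> x}"
    using assms by (intro generate_subgroup_incl) auto
  then show ?thesis using assms by auto
qed

text \<open>The isomorphism is (x, s, y) \<mapsto> x s y. It is a homomorphism because the outer
  factors lie in the central subgroup \<open>P\<close> generated by \<open>z\<close>. The powers
  \<open>z [^] c\<close> and \<open>z [^] a\<close> generate the parts of \<open>P\<close> of order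
  \<open>a\<close> and \<open>c\<close>.\<close>

lemma (in group) iso_central_cyclic_factors:
  assumes z: "z \<in> carrier G" and central: "\<And>g. g \<in> carrier G \<Longrightarrow> z \<otimes> g = g \<otimes> z"
    and ord: "ord z = a * c" "ord z > 0" "coprime a c"
    and K: "subgroup K G" "K \<inter> generate G {z} = {\<one>}"
      "\<And>g. g \<in> carrier G \<Longrightarrow> \<exists>p\<in>generate G {z}. \<exists>k\<in>K. g = p \<otimes> k"
  shows "G\<lparr>carrier := generate G {z [^] c}\<rparr> \<times>\<times> G\<lparr>carrier := K\<rparr> \<times>\<times> G\<lparr>carrier := generate G {z [^] a}\<rparr> \<cong> G"
proof -
  have pos: "a > 0" "c > 0" using ord by auto
  define A where "A = generate G {z [^] c}"
  define C where "C = generate G {z [^] a}"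
  define P where "P = generate G {z}"
  have P: "P = range (\<lambda>i::int. z [^] i)"
    using z by (auto simp: P_def generate_pow)
  have A: "A = range (\<lambda>i::int. z [^] (int c * i))"
    using z by (auto simp: A_def generate_pow int_pow_int[symmetric] int_pow_pow)
  have C: "C = range (\<lambda>i::int. z [^] (int a * i))"
    using z by (auto simp: C_def generate_pow int_pow_int[symmetric] int_pow_pow)
  have subs: "subgroup A G" "subgroup C G" "subgroup P G"
    using z by (auto simp: A_def C_def P_def intro: generate_is_subgroup)
  have carr: "A \<subseteq> carrier G" "C \<subseteq> carrier G" "P \<subseteq> carrier G" "K \<subseteq> carrier G"
    using subs K(1) by (auto dest: subgroup.subset)
  have AP: "A \<subseteq> P" and CP: "C \<subseteq> P" using A C P by auto
  have cen: "p \<otimes> g = g \<otimes> p" if "p \<in> P" "g \<in> carrier G" for p g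
    using generate_central[OF z central] that by (simp add: P_def)
  define h where "h = (\<lambda>(x, s, y). x \<otimes> s \<otimes> y)"
  let ?D = "G\<lparr>carrier := A\<rparr> \<times>\<times> G\<lparr>carrier := K\<rparr> \<times>\<times> G\<lparr>carrier := C\<rparr>"
  have gD: "group ?D"
    using subs K(1) by (intro DirProd_group subgroup.subgroup_is_group) (auto intro: group_axioms)
  have "h \<in> hom ?D G"
  proof (rule homI)
    fix u v assume "u \<in> carrier ?D" "v \<in> carrier ?D"
    then obtain x s y x' s' y' where uv: "u = (x, s, y)" "v = (x', s', y')"
      and mem: "x \<in> A" "s \<in> K" "y \<in> C" "x' \<in> A" "s' \<in> K" "y' \<in> C" by auto
    have c: "x \<in> carrier G" "s \<in> carrier G" "y \<in> carrier G" "x' \<in> carrier G" "s' \<in> carrier G" "y' \<in> carrier G"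
      using mem carr by auto
    have xP: "x' \<in> P" "y \<in> P" using mem AP CP by auto
    have "(x \<otimes> s \<otimes> y) \<otimes> (x' \<otimes> s' \<otimes> y') = x \<otimes> s \<otimes> (y \<otimes> (x' \<otimes> s')) \<otimes> y'"
      using c by (simp add: m_assoc)
    also have "\<dots> = x \<otimes> s \<otimes> ((x' \<otimes> s') \<otimes> y) \<otimes> y'"
      using cen[OF xP(2), of "x' \<otimes> s'"] c by simp
    also have "\<dots> = x \<otimes> (s \<otimes> x') \<otimes> s' \<otimes> (y \<otimes> y')" using c by (simp add: m_assoc)
    also have "\<dots> = x \<otimes> (x' \<otimes> s) \<otimes> s' \<otimes> (y \<otimes> y')" using cen[OF xP(1), of s] c by simp
    also have "\<dots> = (x \<otimes> x') \<otimes> (s \<otimes> s') \<otimes> (y \<otimes> y')" using c by (simp add: m_assoc)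
    finally show "h (u \<otimes>\<^bsub>?D\<^esub> v) = h u \<otimes> h v" by (simp add: uv h_def)
  next
    fix u assume "u \<in> carrier ?D"
    then show "h u \<in> carrier G" using carr by (auto simp: h_def dest!: subsetD)
  qed
  then interpret h: group_hom ?D G h
    using gD by (simp add: group_hom_def group_hom_axioms_def)
  have "h \<in> iso ?D G"
    unfolding h.iso_iff
  proof (intro conjI ballI impI subsetI)
    fix g assume "g \<in> carrier G"
    then obtain p k where pk: "p \<in> P" "k \<in> K" "g = p \<otimes> k" using K(3) unfolding P_def by blast
    then obtain i where i: "p = z [^] (i::int)" using P by auto
    have kc: "k \<in> carrier G" using pk carr by auto
    \<comment> \<open>A Bezout relation for \<open>a\<close> and \<open>c\<close> splits an
      arbitrary power of \<open>z\<close> into a power of \<open>z [^] c\<close> times a power of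
      \<open>z [^] a\<close>.\<close>
    obtain u v where uv: "u * int c + v * int a = 1"
      using ord(3) bezout_int[of "int c" "int a"] by (auto simp: coprime_commute)
    have "p = z [^] (int c * (u * i) + int a * (v * i))"
      using i uv by (metis (no_types, opaque_lifting) distrib_right mult.assoc mult.commute mult_1)
    then have p: "p = z [^] (int c * (u * i)) \<otimes> z [^] (int a * (v * i))" using z by (simp add: int_pow_mult)
    let ?x = "z [^] (int c * (u * i))" and ?y = "z [^] (int a * (v * i))"
    have xy: "?x \<in> A" "?y \<in> C" "?x \<in> carrier G" "?y \<in> carrier G" using A C z by auto
    have "g = h (?x, k, ?y)"
      using pk(3) p cen[of ?y k] xy CP kc by (auto simp: h_def m_assoc)
    then show "g \<in> h ` carrier ?D" using xy pk by (intro image_eqI) auto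
  next
    fix w assume "w \<in> carrier ?D" and hw: "h w = \<one>"
    then obtain x s y where w: "w = (x, s, y)" and mem: "x \<in> A" "s \<in> K" "y \<in> C" by auto
    have c: "x \<in> carrier G" "s \<in> carrier G" "y \<in> carrier G" using mem carr by auto
    have "x \<otimes> (s \<otimes> y) = \<one>" using hw w c by (simp add: h_def m_assoc)
    moreover have "s \<otimes> y = y \<otimes> s" using cen[of y s] mem c CP by auto
    ultimately have xys: "(x \<otimes> y) \<otimes> s = \<one>" using c by (simp add: m_assoc)
    \<comment> \<open>This puts \<open>s\<close> into the trivial intersection of \<open>K\<close>
      and \<open>P\<close>, which leaves a relation between powers of \<open>z\<close>
      alone.\<close>
    then have "s = inv (x \<otimes> y)" using c by (metis inv_equality inv_inv m_closed)
    moreover have "inv (x \<otimes> y) \<in> P"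
      using subs(3) mem AP CP by (blast intro: subgroup.m_inv_closed subgroup.m_closed)
    ultimately have s1: "s = \<one>" using K(2) mem by (auto simp: P_def)
    then have xy: "x \<otimes> y = \<one>" using xys c by simp
    obtain i where i: "x = z [^] (int c * i)" using mem A by auto
    obtain j where j: "y = z [^] (int a * j)" using mem C by auto
    have "z [^] (int c * i + int a * j) = \<one>"
      using xy i j z by (simp add: int_pow_mult)
    then have "int (a * c) dvd int c * i + int a * j"
      using int_pow_eq_id[OF z] ord(1) by simp
    \<comment> \<open>Since \<open>a\<close> divides c i + a j and is coprime to \<open>c\<close>,
      it divides \<open>i\<close>. Then \<open>ord z\<close> divides c i, so \<open>x\<close> is
      trivial.\<close>
    then have "int a dvd int c * i + int a * j" by (metis dvd_mult_left of_nat_mult)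
    then have "int a dvd int c * i" by (metis dvd_add_left_iff dvd_triv_left)
    then have "int a dvd i" using ord(3) by (simp add: coprime_dvd_mult_right_iff)
    then have "x = \<one>" using i z ord(1) by (auto simp: int_pow_eq_id mult.commute)
    then show "w = \<one>\<^bsub>?D\<^esub>" using w s1 xy c by simp
  qed
  then show ?thesis unfolding A_def C_def by (rule is_isoI)
qed

section \<open>Splitting off central cyclic Sylow subgroups\<close>

lemma (in group) cyclic_group_generate:
  assumes "x \<in> carrier G"
  shows "cyclic_group (G\<lparr>carrier := generate G {x}\<rparr>)"
proof -
  have "subgroup_generated G {x} = G\<lparr>carrier := generate G {x}\<rparr>"
    using assms by (simp add: subgroup_generated_def)
  then show ?thesis using cyclic_group_generated[of x] by simp
qed

lemma (in group) cyclic_group_prime_order: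
  assumes "prime (order G)"
  shows "cyclic_group G"
proof -
  have fin: "finite (carrier G)"
    using prime_gt_0_nat[OF assms] by (simp add: order_gt_0_iff_finite)
  have "order G \<noteq> 1" using assms by auto
  then obtain x where x: "x \<in> carrier G" "x \<noteq> \<one>"
    using order_one_triv_iff by auto
  then have "ord x \<noteq> 1" by (metis ord_eq_1)
  then have "ord x = order G"
    using assms ord_dvd_group_order[OF x(1)] by (metis prime_nat_iff)
  then have "generate G {x} = carrier G"
    using generate_pow_card[OF x(1)] fin x
    by (intro card_subset_eq) (auto simp: order_def dest: generate_in_carrier[rotated])
  then have "subgroup_generated G {x} = G" using x by (simp add: subgroup_generated_def)
  then show ?thesis using cyclic_group_alt by blast
qed

text \<open>Each factor is \<open>G\<close> restricted to a subgroup, so all three live in the type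
  of \<open>G\<close>. The splitting comes from a complement to a central Hall subgroup; the absence
  of central cyclic Sylow subgroups in \<open>S\<close> comes from choosing that Hall subgroup
  maximal among the cyclic ones.\<close>

lemma central_cyclic_decomposition:
  fixes G :: "'g monoid" (structure)
  assumes "finite_group G"
  obtains A S C :: "'g monoid" where "G \<cong> A \<times>\<times> S \<times>\<times> C" "coprime_factors A S C"
    "\<And>p. prime p \<Longrightarrow> p dvd order C \<Longrightarrow> 2 \<le> multiplicity p (order C)"
    "\<And>p P. p dvd order S \<Longrightarrow> sylow_subgroup S p P \<Longrightarrow> P \<subseteq> group_center S \<Longrightarrow>
       \<not> cyclic_group (subgroup_generated S P)"
proof -
  interpret group G using assms by (simp add: finite_group_def)
  have fin: "finite (carrier G)" using assms by (simp add: finite_group_def)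
  have ord_pos: "order G > 0" using assms by (rule finite_group_order_pos)
  \<comment> \<open>These are the generators of the central cyclic Hall subgroups. The unit is one
    of them, so a maximal order exists.\<close>
  define Z where "Z = {z \<in> group_center G. coprime (ord z) (order G div ord z)}"
  have "Z \<subseteq> carrier G" by (auto simp: Z_def group_center_def)
  with fin have fin_Z: "finite Z" by (rule rev_finite_subset)
  have "\<one> \<in> Z" by (simp add: Z_def group_center_def)
  then have "Z \<noteq> {}" by auto
  have "Max (ord ` Z) \<in> ord ` Z" using fin_Z \<open>Z \<noteq> {}\<close> by simp
  then obtain z where zZ: "z \<in> Z" and "ord z = Max (ord ` Z)" by force
  then have max: "ord y \<le> ord z" if "y \<in> Z" for y using fin_Z that by simp
  have z: "z \<in> carrier G" and z_central: "\<And>g. g \<in> carrier G \<Longrightarrow> z \<otimes> g = g \<otimes> z"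
    and z_cop: "coprime (ord z) (order G div ord z)"
    using zZ by (auto simp: Z_def group_center_def)
  have ord_z: "ord z > 0" using ord_ge_1[OF fin z] by simp
  define P where "P = generate G {z}"
  have P: "subgroup P G" using z by (auto simp: P_def intro: generate_is_subgroup)
  have P_central: "p \<otimes> g = g \<otimes> p" if "p \<in> P" "g \<in> carrier G" for p g
    using generate_central[OF z z_central] that by (simp add: P_def)
  have card_P: "card P = ord z" using z by (simp add: P_def generate_pow_card)
  obtain K where K: "subgroup K G" "K \<inter> P = {\<one>}"
    "\<And>g. g \<in> carrier G \<Longrightarrow> \<exists>p\<in>P. \<exists>k\<in>K. g = p \<otimes> k"
    using central_Hall_complement[OF fin P P_central] z_cop card_P by metis
  obtain a c where ac: "ord z = a * c" "coprime a c" "squarefree a"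
    and powerful: "\<And>p. prime p \<Longrightarrow> p dvd c \<Longrightarrow> 2 \<le> multiplicity p c"
    using squarefree_powerful_split[OF ord_z] by blast
  have pos: "a > 0" "c > 0" using ac ord_z by auto
  define A where "A = G\<lparr>carrier := generate G {z [^] c}\<rparr>"
  define S where "S = G\<lparr>carrier := K\<rparr>"
  define C where "C = G\<lparr>carrier := generate G {z [^] a}\<rparr>"
  have K_sub: "K \<subseteq> carrier G" using K(1) by (rule subgroup.subset)
  have ordA: "order A = a" and ordC: "order C = c" and ordS: "order S = card K"
    using z ac pos
    by (simp_all add: A_def C_def S_def order_def generate_pow_card[symmetric] ord_pow)
  have grp: "group A" "group S" "group C"
    using z K(1) unfolding A_def S_def C_def
    by (auto intro!: subgroup.subgroup_is_group generate_is_subgroup group_axioms)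
  have finS: "finite_group S"
    using grp fin K_sub by (auto simp: finite_group_def S_def intro: finite_subset)
  have finA: "finite_group A" and finC: "finite_group C"
    using grp ordA ordC pos by (auto simp: finite_group_def order_def card_gt_0_iff)
  have iso: "A \<times>\<times> S \<times>\<times> C \<cong> G"
    unfolding A_def S_def C_def
    using iso_central_cyclic_factors[OF z z_central ac(1) ord_z ac(2) K(1)] K(2,3)
    by (simp add: P_def)
  have ordG: "order G = ord z * card K"
    using iso_same_card[OF iso] ordA ordC ordS ac(1)
    by (simp add: order_def[symmetric] order_DirProd mult_ac del: carrier_DirProd)
  have cop: "coprime (ord z) (card K)" using z_cop ordG ord_z by simp
  show ?thesis
  proof
    show "G \<cong> A \<times>\<times> S \<times>\<times> C"
      by (intro group.iso_sym[OF _ iso] DirProd_group grp)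
    show "coprime_factors A S C"
      unfolding coprime_factors_def
    proof (intro conjI)
      show "cyclic_group A" "cyclic_group C"
        unfolding A_def C_def using z by (auto intro: cyclic_group_generate)
      show "gcd (order A) (order S * order C) = 1" "gcd (order S) (order C) = 1"
        using cop ac by (auto simp: ordA ordC ordS coprime_commute coprime_iff_gcd_eq_1[symmetric])
    qed (use finA finS finC ordA ac in auto)
    show "2 \<le> multiplicity p (order C)" if "prime p" "p dvd order C" for p
      using powerful that by (simp add: ordC)
    fix p Q
    assume p: "p dvd order S" and Q: "sylow_subgroup S p Q" and Q_central: "Q \<subseteq> group_center S"
    show "\<not> cyclic_group (subgroup_generated S Q)"
    proof
      assume cyc: "cyclic_group (subgroup_generated S Q)"
      define k where "k = multiplicity p (card K)"
      have prime: "prime p" and Q_sub: "subgroup Q S" and card_Q: "card Q = p ^ k"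
        using Q by (auto simp: sylow_subgroup_def k_def ordS)
      define H where "H = subgroup_generated S Q"
      interpret S: group S by (rule grp)
      have H: "group H" unfolding H_def by (rule S.group_subgroup_generated)
      interpret H: group H by (rule H)
      have carrier_H: "carrier H = Q"
        unfolding H_def using Q_sub by (rule subgroup.carrier_subgroup_generated_subgroup)
      obtain x where x: "x \<in> Q" "subgroup_generated H {x} = H"
        using cyc carrier_H by (auto simp: cyclic_group_def H_def)
      have xK: "x \<in> K" using x(1) subgroup.subset[OF Q_sub] by (auto simp: S_def)
      then have xG: "x \<in> carrier G" using K_sub by auto
      have "H.ord x = p ^ k"
        using H.ord_generator[of x] x carrier_H card_Q by (simp add: order_def)
      \<comment> \<open>\<open>H\<close> shares multiplication and unit with \<open>G\<close>, so
        the order of the generator \<open>x\<close> is the same in both.\<close>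
      moreover have "x [^]\<^bsub>H\<^esub> n = x [^] n" for n :: nat
        by (simp add: H_def pow_subgroup_generated S_def nat_pow_consistent[symmetric])
      moreover have "\<one>\<^bsub>H\<^esub> = \<one>" by (simp add: H_def S_def)
      ultimately have "\<forall>n. x [^] n = \<one> \<longleftrightarrow> p ^ k dvd n"
        using H.pow_eq_id[of x] x(1) carrier_H by metis
      then have ord_x: "ord x = p ^ k" using xG by (simp add: ord_unique)
      \<comment> \<open>Centrality in \<open>S\<close> extends to \<open>G\<close> because G = P K
        and \<open>P\<close> is central.\<close>
      have x_central: "x \<otimes> g = g \<otimes> x" if g: "g \<in> carrier G" for g
      proof -
        obtain q l where ql: "q \<in> P" "l \<in> K" "g = q \<otimes> l" using K(3) g by blast
        have c: "q \<in> carrier G" "l \<in> carrier G" using ql K_sub subgroup.subset[OF P] by auto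
        have xl: "x \<otimes> l = l \<otimes> x" using Q_central x(1) ql(2) by (auto simp: group_center_def S_def)
        have "x \<otimes> g = (x \<otimes> q) \<otimes> l" using ql c xG by (simp add: m_assoc)
        also have "\<dots> = q \<otimes> (x \<otimes> l)" using P_central[OF ql(1) xG] c xG by (simp add: m_assoc[symmetric])
        also have "\<dots> = g \<otimes> x" using xl ql c xG by (simp add: m_assoc)
        finally show ?thesis .
      qed
      have K_pos: "card K > 0" using ordG ord_pos by (auto intro: gr0I)
      obtain r where r: "card K = p ^ k * r" "\<not> p dvd r"
        using multiplicity_decompose'[of "card K" p] K_pos prime unfolding k_def by (metis not_gr_zero not_prime_unit)
      have "k > 0" unfolding k_def using p prime K_pos by (simp add: ordS prime_multiplicity_gt_zero_iff)
      \<comment> \<open>The orders of \<open>z\<close> and \<open>x\<close> are coprime, so they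
        multiply. The remaining index \<open>r\<close> is prime to both, so
        \<open>z \<otimes> x\<close> belongs to \<open>Z\<close> and has larger order than
        \<open>z\<close>.\<close>
      have ord_zx: "ord (z \<otimes> x) = ord z * p ^ k"
        using ord_mult_coprime[OF z xG z_central[OF xG]] cop r(1) ord_x by simp
      have "order G div (ord z * p ^ k) = r"
        using ordG r(1) ord_z prime by (simp add: prime_gt_0_nat)
      moreover have "coprime (ord z * p ^ k) r"
        using cop r prime by (simp add: prime_imp_coprime)
      moreover have "z \<otimes> x \<otimes> g = g \<otimes> (z \<otimes> x)" if g: "g \<in> carrier G" for g
      proof -
        have "z \<otimes> x \<otimes> g = (z \<otimes> g) \<otimes> x" using z xG g x_central[OF g] by (simp add: m_assoc)
        then show ?thesis using z xG g z_central[OF g] by (simp add: m_assoc)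
      qed
      ultimately have "z \<otimes> x \<in> Z" using z xG by (simp add: Z_def ord_zx group_center_def)
      from max[OF this] have "p ^ k \<le> 1" using ord_z by (simp add: ord_zx)
      moreover have "p ^ k > 1" using prime_gt_1_nat[OF prime] \<open>k > 0\<close> by (intro one_less_power)
      ultimately show False by simp
    qed
  qed
qed

text \<open>Groups of prime order are cyclic, so excluding central cyclic Sylow subgroups already
  forces \<open>S\<close> to be squarefree-reduced.\<close>

lemma fundamental_blockI:
  assumes "finite_group S" "\<not> trivial_group S" "group_lambda S < 59 / 8"
    and no: "\<And>p P. p dvd order S \<Longrightarrow> sylow_subgroup S p P \<Longrightarrow> P \<subseteq> group_center S \<Longrightarrow>
       \<not> cyclic_group (subgroup_generated S P)"
  shows "fundamental_block S"
proof -
  have "squarefree_reduced S"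
    unfolding squarefree_reduced_def
  proof clarify
    fix p P assume P: "sylow_subgroup S p P" "P \<subseteq> group_center S" "prime (card P)"
    interpret S: group S using assms(1) by (simp add: finite_group_def)
    interpret group "subgroup_generated S P" by simp
    have sub: "subgroup P S" using P by (simp add: sylow_subgroup_def)
    then have "order (subgroup_generated S P) = card P"
      by (simp add: order_def subgroup.carrier_subgroup_generated_subgroup)
    then have "cyclic_group (subgroup_generated S P)"
      using P(3) by (intro cyclic_group_prime_order) simp
    \<comment> \<open>For a prime not dividing the order, \<open>sylow_subgroup\<close> holds of the
      trivial subgroup, whose size 1 is not prime.\<close>
    moreover have "p dvd order S"
    proof (rule ccontr)
      assume "\<not> p dvd order S"
      then have "card P = 1" using P(1) by (simp add: sylow_subgroup_def not_dvd_imp_multiplicity_0)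
      then show False using P(3) by simp
    qed
    ultimately show False using no P by blast
  qed
  then show ?thesis using assms by (auto simp: fundamental_block_def)
qed

section \<open>Primary decompositions\<close>

text \<open>The tuple of ones is a generator: its powers are the tuples of residues of one integer,
  and by the Chinese remainder theorem every tuple is of this form.\<close>

lemma cyclic_product_integer_mod_groups:
  assumes fin: "finite I" and pos: "\<And>i. i \<in> I \<Longrightarrow> q i > 0"
    and cop: "\<And>i j. i \<in> I \<Longrightarrow> j \<in> I \<Longrightarrow> i \<noteq> j \<Longrightarrow> coprime (q i) (q j)"
  shows "cyclic_group (product_group I (\<lambda>i. integer_mod_group (q i)))" (is "cyclic_group ?G")
proof -
  interpret group ?G by simp
  \<comment> \<open>Reducing 1 modulo \<open>q i\<close> matters when \<open>q i\<close> is 1, where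
    the only residue is 0.\<close>
  define g where "g = (\<lambda>i\<in>I. 1 mod int (q i))"
  have g: "g \<in> carrier ?G" using pos by (auto simp: g_def carrier_integer_mod_group)
  have pow: "g [^]\<^bsub>?G\<^esub> n = (\<lambda>i\<in>I. int n mod int (q i))" for n :: nat
  proof (induction n)
    case (Suc n)
    then show ?case by (auto simp: g_def mod_simps add.commute intro!: restrict_ext)
  qed (auto simp: g_def)
  have "carrier ?G \<subseteq> range (\<lambda>n::int. g [^]\<^bsub>?G\<^esub> n)"
  proof
    fix x assume x: "x \<in> carrier ?G"
    obtain k where k: "\<And>i. i \<in> I \<Longrightarrow> [k = nat (x i)] (mod q i)"
      using chinese_remainder_nat[OF fin, of q "\<lambda>i. nat (x i)"] cop by blast
    have "x i = int k mod int (q i)" if i: "i \<in> I" for i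
    proof -
      have xi: "0 \<le> x i" "x i < int (q i)"
        using x i pos[OF i] by (auto simp: PiE_iff carrier_integer_mod_group)
      have "int k mod int (q i) = int (nat (x i)) mod int (q i)"
        using k[OF i] by (metis cong_def zmod_int)
      then show ?thesis using xi by simp
    qed
    moreover have "x \<in> extensional I" using x by (simp add: PiE_iff)
    ultimately have "x = g [^]\<^bsub>?G\<^esub> k"
      by (auto simp: pow extensional_def restrict_def fun_eq_iff)
    then have "x = g [^]\<^bsub>?G\<^esub> int k" by (simp only: int_pow_int)
    then show "x \<in> range (\<lambda>n::int. g [^]\<^bsub>?G\<^esub> n)" by blast
  qed
  then have "carrier ?G = range (\<lambda>n::int. g [^]\<^bsub>?G\<^esub> n)" using g by blast
  then show ?thesis using g cyclic_group by blast
qed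

lemma order_product_integer_mod_groups:
  assumes "finite I" "\<And>i. i \<in> I \<Longrightarrow> q i > 0"
  shows "order (product_group I (\<lambda>i. integer_mod_group (q i))) = (\<Prod>i\<in>I. q i)"
proof -
  have "card (carrier (integer_mod_group (q i))) = q i" if "i \<in> I" for i
    using assms(2)[OF that] by (simp add: carrier_integer_mod_group)
  then show ?thesis using assms(1) by (simp add: order_def card_PiE)
qed

lemma cyclic_integer_mod_group:
  assumes "n > 0"
  shows "cyclic_group (integer_mod_group n)"
proof -
  interpret group "integer_mod_group n" by simp
  have "carrier (integer_mod_group n) = range (\<lambda>m::int. (1 mod int n) [^]\<^bsub>integer_mod_group n\<^esub> m)"
  proof (intro equalityI subsetI)
    fix x assume "x \<in> carrier (integer_mod_group n)"
    then have "x = (1 mod int n) [^]\<^bsub>integer_mod_group n\<^esub> x"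
      using assms by (simp add: int_pow_integer_mod_group carrier_integer_mod_group mod_simps)
    then show "x \<in> range (\<lambda>m::int. (1 mod int n) [^]\<^bsub>integer_mod_group n\<^esub> m)" by blast
  qed (use assms in \<open>auto simp: int_pow_integer_mod_group carrier_integer_mod_group\<close>)
  moreover have "1 mod int n \<in> carrier (integer_mod_group n)"
    using assms by (simp add: carrier_integer_mod_group)
  ultimately show ?thesis using cyclic_group by blast
qed

text \<open>No explicit isomorphism is needed: the product is cyclic because its orders are pairwise
  coprime, and finite cyclic groups of equal order are isomorphic.\<close>

lemma primary_decompositionI:
  assumes "finite_group C" "cyclic_group C" "length ls = length as" "distinct ls"
    and prime: "\<forall>l\<in>set ls. prime l" and "\<forall>a\<in>set as. 1 \<le> a"
    and ord: "order C = (\<Prod>i<length as. ls ! i ^ as ! i)"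
  shows "primary_decomposition C ls as"
proof -
  let ?q = "\<lambda>i. ls ! i ^ as ! i"
  let ?G = "product_group {..<length as} (\<lambda>i. integer_mod_group (?q i))"
  have pos: "?q i > 0" if "i \<in> {..<length as}" for i
    using that prime assms(3) by (simp add: prime_gt_0_nat)
  have "coprime (?q i) (?q j)" if "i \<in> {..<length as}" "j \<in> {..<length as}" "i \<noteq> j" for i j
  proof -
    have "ls ! i \<noteq> ls ! j" using that assms(3,4) by (simp add: nth_eq_iff_index_eq)
    then have "coprime (ls ! i) (ls ! j)" using that prime assms(3) by (intro primes_coprime) auto
    then show ?thesis by simp
  qed
  then have "cyclic_group ?G" using pos by (intro cyclic_product_integer_mod_groups) auto
  moreover have "order ?G = order C"
    unfolding ord using pos by (intro order_product_integer_mod_groups) auto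
  moreover from this have "finite_group ?G"
    using finite_group_order_pos[OF assms(1)] monoid.order_gt_0_iff_finite[of ?G]
    by (simp add: finite_group_def group.is_monoid del: carrier_product_group)
  ultimately have "C \<cong> ?G" using assms(1,2) by (intro cyclic_groups_iso) auto
  then show ?thesis using assms by (simp add: primary_decomposition_def)
qed

text \<open>As the primes in \<open>ls\<close> are distinct, the exponents can be indexed by the
  primes instead of by list positions.\<close>

lemma primary_decompositionE:
  assumes "primary_decomposition C ls as"
  obtains f where "as = map f ls" "order C = (\<Prod>l\<in>set ls. l ^ f l)" "\<forall>l\<in>set ls. 1 \<le> f l"
    "distinct ls" "\<forall>l\<in>set ls. prime l"
proof -
  note pd = assms[unfolded primary_decomposition_def]
  let ?q = "\<lambda>i. ls ! i ^ as ! i"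
  define f where "f = (\<lambda>l. the (map_of (zip ls as) l))"
  have f: "f (ls ! i) = as ! i" if "i < length ls" for i
    using pd that by (simp add: f_def map_of_zip_nth)
  have as: "as = map f ls" using pd f by (intro nth_equalityI) auto
  have pos: "?q i > 0" if "i \<in> {..<length as}" for i
    using that pd by (simp add: prime_gt_0_nat)
  have "order C = order (product_group {..<length as} (\<lambda>i. integer_mod_group (?q i)))"
    unfolding order_def using pd by (intro iso_same_card) blast
  also have "\<dots> = (\<Prod>i<length as. ?q i)"
    using pos by (intro order_product_integer_mod_groups) auto
  also have "\<dots> = (\<Prod>i<length ls. ls ! i ^ f (ls ! i))" using pd f by (intro prod.cong) auto
  also have "\<dots> = (\<Prod>l\<in>set ls. l ^ f l)"
    using pd by (intro prod.reindex_bij_betw bij_betw_nth) auto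
  finally have ord: "order C = (\<Prod>l\<in>set ls. l ^ f l)" .
  show ?thesis
  proof (rule that[OF as ord])
    show "\<forall>l\<in>set ls. 1 \<le> f l" using pd unfolding as by simp
  qed (use pd in auto)
qed

text \<open>Unique factorization of \<open>order C\<close> recovers both the primes and their
  exponents, so two primary decompositions of \<open>C\<close> differ only in the order of the
  factors.\<close>

lemma primary_decomposition_multiplicity:
  assumes "primary_decomposition C ls as"
  shows "as = map (\<lambda>p. multiplicity p (order C)) ls" "set ls = prime_factors (order C)"
proof -
  obtain f where f: "as = map f ls" "order C = (\<Prod>l\<in>set ls. l ^ f l)" "\<forall>l\<in>set ls. 1 \<le> f l"
    "distinct ls" "\<forall>l\<in>set ls. prime l"
    using assms by (rule primary_decompositionE)
  have mult: "multiplicity p (order C) = (if p \<in> set ls then f p else 0)" if "prime p" for p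
    using f that by (simp add: multiplicity_prod_prime_powers)
  show "as = map (\<lambda>p. multiplicity p (order C)) ls" using f mult by simp
  have "p \<in> set ls \<longleftrightarrow> p \<in> prime_factors (order C)" for p
    using f(3,5) mult[of p] by (cases "prime p") (auto simp: prime_factors_multiplicity Suc_le_eq)
  then show "set ls = prime_factors (order C)" by blast
qed

lemma primary_decomposition_exists:
  assumes "finite_group C" "cyclic_group C"
  shows "\<exists>ls as. primary_decomposition C ls as"
proof -
  define ls where "ls = sorted_list_of_set (prime_factors (order C))"
  have pos: "order C > 0" using assms by (simp add: finite_group_order_pos)
  have ls: "set ls = prime_factors (order C)" "distinct ls" by (auto simp: ls_def)
  let ?m = "\<lambda>p. multiplicity p (order C)"
  have "order C = (\<Prod>l\<in>set ls. l ^ ?m l)"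
    using pos ls by (simp add: prime_factorization_nat[symmetric])
  also have "\<dots> = (\<Prod>i<length ls. ls ! i ^ ?m (ls ! i))"
    using ls by (intro prod.reindex_bij_betw[symmetric] bij_betw_nth) auto
  also have "\<dots> = (\<Prod>i<length (map ?m ls). ls ! i ^ map ?m ls ! i)" by simp
  finally have "primary_decomposition C ls (map ?m ls)"
    using assms ls by (intro primary_decompositionI) (auto simp: prime_factors_multiplicity)
  then show ?thesis by blast
qed

text \<open>The right-hand side mentions only \<open>order C\<close>, so the condition holds for all
  primary decompositions as soon as it holds for one.\<close>

lemma primary_decomposition_exponents_ge_2:
  assumes "primary_decomposition C ls as"
  shows "(\<forall>a\<in>set as. 2 \<le> a) \<longleftrightarrow> (\<forall>p\<in>prime_factors (order C). 2 \<le> multiplicity p (order C))"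
proof -
  have "set as = (\<lambda>p. multiplicity p (order C)) ` prime_factors (order C)"
    using arg_cong[OF primary_decomposition_multiplicity(1)[OF assms], of set]
      primary_decomposition_multiplicity(2)[OF assms] by simp
  then show ?thesis by simp
qed

text \<open>A prime with exponent a contributes a + 1 to the divisor count and one factor 2 to the
  denominator.\<close>

lemma primary_decomposition_group_delta:
  assumes "finite_group C" "primary_decomposition C ls as"
  shows "group_delta C = prod_list (map (\<lambda>a. (real a + 1) / 2) as)"
proof -
  let ?m = "\<lambda>p. multiplicity p (order C)"
  note pd = primary_decomposition_multiplicity[OF assms(2)]
  have "distinct ls" using assms(2) by (simp add: primary_decomposition_def)
  have "prod_list (map (\<lambda>a. (real a + 1) / 2) as) = prod_list (map (\<lambda>p. (real (?m p) + 1) / 2) ls)"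
    by (subst pd(1)) (simp add: comp_def)
  also have "\<dots> = (\<Prod>p\<in>prime_factors (order C). (real (?m p) + 1) / 2)"
    using \<open>distinct ls\<close> by (simp add: prod.distinct_set_conv_list flip: pd(2))
  also have "\<dots> = (\<Prod>p\<in>prime_factors (order C). real (?m p + 1)) / 2 ^ prime_count C"
    by (simp add: prod_dividef prime_count_def add.commute)
  also have "\<dots> = group_delta C"
    using finite_group_order_pos[OF assms(1)]
    by (simp add: group_delta_def card_divisors_eq)
  finally show ?thesis ..
qed

section \<open>Patterns for trivial \<open>S\<close>, and assembly of the theorem\<close>

lemma coprime_factors_threshold_iff:
  assumes "coprime_factors A S C" "trivial_group S" "exponent_pattern C as"
  shows "threshold_decomposition A S C \<longleftrightarrow> as \<in> threshold_patterns"
proof -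
  obtain ls where sorted: "sorted_wrt (\<ge>) as" and pd: "primary_decomposition C ls as"
    using assms(3) by (auto simp: exponent_pattern_def)
  have "finite_group C" using assms(1) by (simp add: coprime_factors_def)
  then have lam: "group_lambda S * group_delta C = prod_list (map (\<lambda>a. (real a + 1) / 2) as)"
    using assms(2) pd by (simp add: group_lambda_trivial primary_decomposition_group_delta)
  \<comment> \<open>The exponent condition quantifies over all decompositions; it is equivalent to
    the condition on the given one.\<close>
  have ge: "(\<forall>ls as. primary_decomposition C ls as \<longrightarrow> (\<forall>a\<in>set as. 2 \<le> a)) \<longleftrightarrow> (\<forall>a\<in>set as. 2 \<le> a)"
    using pd primary_decomposition_exponents_ge_2 by blast
  have "threshold_decomposition A S C \<longleftrightarrow>
      prod_list (map (\<lambda>a. (real a + 1) / 2) as) < 59 / 8 \<and> (\<forall>a\<in>set as. 2 \<le> a)"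
    unfolding threshold_decomposition_def ge lam using assms pd by blast
  moreover have "\<forall>a\<in>set as. 2 \<le> a" if "as \<in> threshold_patterns"
    using that by (auto simp: threshold_patterns_def)
  ultimately show ?thesis using prod_list_half_threshold_iff[OF sorted] by blast
qed

text \<open>Patterns have at most four entries, so the primes 2, 3, 5, 7 suffice. The group
  \<open>C\<close> is the integers modulo the resulting product, and \<open>A\<close> and
  \<open>S\<close> are the trivial group of integers modulo 1.\<close>

lemma threshold_pattern_realized:
  assumes "as \<in> threshold_patterns"
  shows "\<exists>(A :: int monoid) (S :: int monoid) (C :: int monoid). coprime_factors A S C \<and> trivial_group S \<and> exponent_pattern C as"
proof -
  have as: "sorted_wrt (\<ge>) as" "\<forall>a\<in>set as. 1 \<le> a" and len: "length as \<le> 4"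
    using assms by (auto simp: threshold_patterns_def)
  define ls :: "nat list" where "ls = take (length as) [2, 3, 5, 7]"
  have ls: "length ls = length as" "distinct ls"
    using len by (simp_all add: ls_def)
  have "set ls \<subseteq> {2, 3, 5, 7}" using set_take_subset[of "length as" "[2, 3, 5, 7 :: nat]"] by (simp add: ls_def)
  moreover have "prime (2::nat)" "prime (3::nat)" "prime (5::nat)" "prime (7::nat)"
    by (simp_all add: prime_nat_numeral_eq)
  ultimately have prime: "\<forall>l\<in>set ls. prime l" by auto
  define n where "n = (\<Prod>i<length as. ls ! i ^ as ! i)"
  have n: "n > 0" unfolding n_def using prime ls by (intro prod_pos) (auto simp: prime_gt_0_nat)
  have fin: "finite_group (integer_mod_group m)" "order (integer_mod_group m) = m" if "m > 0" for m
    using that by (auto simp: finite_group_def carrier_integer_mod_group order_def)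
  define C where "C = integer_mod_group n"
  define T where "T = integer_mod_group 1"
  have C: "finite_group C" "order C = n" "cyclic_group C"
    using n fin by (auto simp: C_def cyclic_integer_mod_group)
  have T: "finite_group T" "order T = 1" "cyclic_group T" "trivial_group T"
    using fin[of 1] by (auto simp: T_def cyclic_integer_mod_group trivial_integer_mod_group)
  have "coprime_factors T T C" using C T by (simp add: coprime_factors_def)
  moreover have "exponent_pattern C as"
    using C ls as prime unfolding exponent_pattern_def
    by (auto intro!: exI[of _ ls] primary_decompositionI simp: n_def)
  ultimately show ?thesis using T by blast
qed

theorem corollary6p5:
  "(\<forall>G :: ('g, 'm) monoid_scheme.
      finite_group G \<and> real (sub_count G) < 59 * 2 powi (int (prime_count G) - 3) \<longrightarrow>
      (\<exists>(A :: 'g monoid) (S :: 'g monoid) (C :: 'g monoid). G \<cong> A \<times>\<times> S \<times>\<times> C \<and> threshold_decomposition A S C)) \<and>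
   (\<forall>(A :: ('a, 'x) monoid_scheme) (S :: ('s, 'y) monoid_scheme) (C :: ('c, 'z) monoid_scheme).
      threshold_decomposition A S C \<longrightarrow>
      real (sub_count (A \<times>\<times> S \<times>\<times> C)) < 59 * 2 powi (int (prime_count (A \<times>\<times> S \<times>\<times> C)) - 3)) \<and>
   (\<forall>(A :: ('a, 'x) monoid_scheme) (S :: ('s, 'y) monoid_scheme) (C :: ('c, 'z) monoid_scheme) as.
      coprime_factors A S C \<and> trivial_group S \<and> exponent_pattern C as \<longrightarrow>
      (threshold_decomposition A S C \<longleftrightarrow> as \<in> threshold_patterns)) \<and>
   {as. \<exists>(A :: int monoid) (S :: int monoid) (C :: int monoid).
      threshold_decomposition A S C \<and> trivial_group S \<and> exponent_pattern C as}
     = threshold_patterns"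
proof (intro conjI allI impI)
  fix G :: "('g, 'm) monoid_scheme"
  assume G: "finite_group G \<and> real (sub_count G) < 59 * 2 powi (int (prime_count G) - 3)"
  \<comment> \<open>Dropping the extra record fields of \<open>G\<close> gives a plain monoid, the
    type required of the factors.\<close>
  define M :: "'g monoid" where "M = \<lparr>carrier = carrier G, monoid.mult = monoid.mult G, one = one G\<rparr>"
  have gG: "group G" using G by (simp add: finite_group_def)
  have "id \<in> iso G M" by (simp add: iso_def hom_def M_def)
  then have GM: "G \<cong> M" by (rule is_isoI)
  have "group M" using gG unfolding M_def group_def group_axioms_def monoid_def Units_def by simp
  then have "finite_group M" using G by (simp add: finite_group_def M_def)
  then obtain A S C :: "'g monoid" where MA: "M \<cong> A \<times>\<times> S \<times>\<times> C" and cf: "coprime_factors A S C"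
    and powerful: "\<And>p. prime p \<Longrightarrow> p dvd order C \<Longrightarrow> 2 \<le> multiplicity p (order C)"
    and no_sylow: "\<And>p P. p dvd order S \<Longrightarrow> sylow_subgroup S p P \<Longrightarrow> P \<subseteq> group_center S \<Longrightarrow>
       \<not> cyclic_group (subgroup_generated S P)"
    by (rule central_cyclic_decomposition) (rule that; assumption)
  have fins: "finite_group A" "finite_group S" "finite_group C" and cyc: "cyclic_group C"
    using cf by (auto simp: coprime_factors_def)
  then have "group (A \<times>\<times> S \<times>\<times> C)" by (simp add: finite_group_def DirProd_group)
  have GA: "G \<cong> A \<times>\<times> S \<times>\<times> C" using GM MA by (rule iso_trans)
  have "group_lambda G = group_lambda (A \<times>\<times> S \<times>\<times> C)"
    using sub_count_iso[OF gG \<open>group (A \<times>\<times> S \<times>\<times> C)\<close> GA] prime_count_iso[OF GA]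
    by (simp add: group_lambda_def)
  then have lam: "group_lambda S * group_delta C < 59 / 8"
    using G group_lambda_less_iff[of G] cf by (simp add: coprime_factors_lambda)
  \<comment> \<open>Since \<delta>(C) \<ge> 1, the bound on the product passes to \<lambda>(S), as a
    fundamental block requires.\<close>
  have "group_lambda S \<le> group_lambda S * group_delta C"
    using group_delta_ge_1[OF fins(3)] mult_left_mono[of 1 "group_delta C" "group_lambda S"]
    by (simp add: group_lambda_def)
  then have block: "trivial_group S \<or> fundamental_block S"
    using lam fins no_sylow fundamental_blockI[of S] by force
  have "\<forall>p\<in>prime_factors (order C). 2 \<le> multiplicity p (order C)"
    using powerful by auto
  then have "threshold_decomposition A S C"
    unfolding threshold_decomposition_def
    using cf block lam primary_decomposition_exists[OF fins(3) cyc] primary_decomposition_exponents_ge_2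
    by blast
  then show "\<exists>(A :: 'g monoid) (S :: 'g monoid) (C :: 'g monoid). G \<cong> A \<times>\<times> S \<times>\<times> C \<and> threshold_decomposition A S C"
    using GA by blast
next
  fix A :: "('a, 'x) monoid_scheme" and S :: "('s, 'y) monoid_scheme" and C :: "('c, 'z) monoid_scheme"
  assume "threshold_decomposition A S C"
  then show "real (sub_count (A \<times>\<times> S \<times>\<times> C)) < 59 * 2 powi (int (prime_count (A \<times>\<times> S \<times>\<times> C)) - 3)"
    by (simp add: threshold_decomposition_def coprime_factors_lambda flip: group_lambda_less_iff)
next
  fix A :: "('a, 'x) monoid_scheme" and S :: "('s, 'y) monoid_scheme" and C :: "('c, 'z) monoid_scheme"
    and as
  assume "coprime_factors A S C \<and> trivial_group S \<and> exponent_pattern C as"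
  then show "threshold_decomposition A S C \<longleftrightarrow> as \<in> threshold_patterns"
    using coprime_factors_threshold_iff by blast
next
  show "{as. \<exists>(A :: int monoid) (S :: int monoid) (C :: int monoid).
      threshold_decomposition A S C \<and> trivial_group S \<and> exponent_pattern C as} = threshold_patterns"
  proof (intro equalityI subsetI)
    fix as assume "as \<in> {as. \<exists>(A :: int monoid) (S :: int monoid) (C :: int monoid).
      threshold_decomposition A S C \<and> trivial_group S \<and> exponent_pattern C as}"
    then obtain A S C :: "int monoid"
      where "threshold_decomposition A S C" "trivial_group S" "exponent_pattern C as" by blast
    then show "as \<in> threshold_patterns"
      using coprime_factors_threshold_iff[of A S C as] by (simp add: threshold_decomposition_def)
  next
    fix as :: "nat list" assume as: "as \<in> threshold_patterns"
    then obtain A S C :: "int monoid"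
      where *: "coprime_factors A S C" "trivial_group S" "exponent_pattern C as"
      using threshold_pattern_realized by blast
    then have "threshold_decomposition A S C"
      using as coprime_factors_threshold_iff by blast
    with * show "as \<in> {as. \<exists>(A :: int monoid) (S :: int monoid) (C :: int monoid).
      threshold_decomposition A S C \<and> trivial_group S \<and> exponent_pattern C as}"
      by blast
  qed
qed

end
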